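(* Let $m\in\mathbb{N}$. There is a constant $c>0$ depending only on $m$ such that for every $0<\varepsilon\le1$ and every $\eta\in\mathbb{S}^1$, with $a=e^{\varepsilon}$, the function $$G_\varepsilon(x\cdot\eta):=\frac{2^{2m-2}}{m}\sum_{n\in\mathbb{Z}}\frac{\varepsilon^{-1}}{(1+\varepsilon^{-2}(\rho(x,\eta)+2\pi n)^2)^m},\quad x\in\mathbb{S}^1,$$ satisfies $$0<G_\varepsilon(x\cdot\eta)\le c\,\frac{\varepsilon^{-1}}{(1+\varepsilon^{-1}\rho(x,\eta))^{2m}},\quad x\in\mathbb{S}^1,$$ and $$\int_{\mathbb{S}^1}G_\varepsilon(x\cdot\eta)\,d\sigma(x)=\frac{\pi(2m-2)!}{(m-1)!\,m!}.$$ Moreover, $G_\varepsilon(x\cdot\eta)$ is the restriction to $\mathbb{S}^1$ of the following harmonic function, defined for $x\in\mathbb{R}^2\setminus\{a\eta\}$: $$-\frac12\,\frac{(2m-2)!}{m!\,(m-1)!}+\sum_{\ell=1}^m Q_\ell(2\varepsilon)\frac{(2\varepsilon)^{\ell-1}a^\ell}{\ell!}(\eta\cdot\nabla)^\ell\ln\frac{1}{|x-a\eta|},$$ where $$Q_\ell(u)=\sum_{k=\ell}^m\frac{\ell\,(2m-k-1)!}{m!\,(m-k)!}\,\frac{A_{k-1,\ell-1}}{(k-1)!}\,u^{k-\ell},\quad1\le\ell\le m,$$ $$A_{k,\ell}=\sum_{\nu=\ell}^k(-1)^{\nu-\ell}\binom{\nu}{\ell}\nu!\,S_{k,\nu},\quad0\le\ell\le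 k,$$ and $S_{k,\nu}$ denote the Stirling numbers of the second kind, defined by $$u^k=\sum_{\nu=0}^k S_{k,\nu}\,u(u-1)\cdots(u-\nu+1),\quad k=0,1,\dots.$$
   Context: $|\cdot|$ is the Euclidean norm and $x\cdot y$ the dot product on $\mathbb{R}^2$; $\mathbb{S}^1$ is the unit circle in $\mathbb{R}^2$; $\rho(x,\eta):=\arccos(x\cdot\eta)$ is the geodesic distance on $\mathbb{S}^1$; $\sigma$ is the Lebesgue (arc length) measure on $\mathbb{S}^1$. $(\eta\cdot\nabla)^\ell$ is the $\ell$th directional derivative (in $x$) in direction $\eta$. *)

theory Defs
  imports "HOL-Analysis.Analysis" "HOL-Combinatorics.Stirling"
begin

section \<open>Directional derivatives and harmonic functions\<close>

definition dir_deriv :: "'a::euclidean_space \<Rightarrow> ('a \<Rightarrow> real) \<Rightarrow> 'a \<Rightarrow> real" where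
  "dir_deriv v f x = deriv (\<lambda>t::real. f (x + t *\<^sub>R v)) 0"

definition laplacian :: "('a::euclidean_space \<Rightarrow> real) \<Rightarrow> 'a \<Rightarrow> real" where
  "laplacian f x = (\<Sum>i\<in>Basis. dir_deriv i (dir_deriv i f) x)"

text \<open>The first three conjuncts after openness say that \<open>f\<close> is of class \<open>C\<^sup>2\<close> on \<open>S\<close>; since
  \<^const>\<open>deriv\<close> is total, differentiability is required before derivatives are mentioned.\<close>

definition harmonic_on :: "('a::euclidean_space \<Rightarrow> real) \<Rightarrow> 'a set \<Rightarrow> bool" where
  "harmonic_on f S \<longleftrightarrow> open S \<and>
     f differentiable_on S \<and>
     (\<forall>i\<in>Basis. dir_deriv i f differentiable_on S) \<and>
     (\<forall>i\<in>Basis. \<forall>j\<in>Basis. continuous_on S (dir_deriv j (dir_deriv i f))) \<and>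
     (\<forall>x\<in>S. laplacian f x = 0)"


section \<open>The unit circle\<close>

definition geodist :: "real^2 \<Rightarrow> real^2 \<Rightarrow> real" where
  "geodist x \<eta> = arccos (x \<bullet> \<eta>)"

text \<open>Arc length on the unit circle, as the image of Lebesgue measure on \<open>[0, 2\<pi>)\<close> under the
  unit speed parametrisation.\<close>

definition arc_measure :: "(real^2) measure" where
  "arc_measure = distr (restrict_space lborel {0..<2*pi}) (restrict_space borel (sphere 0 1))
                   (\<lambda>t. vector [cos t, sin t])"


section \<open>The kernel and the coefficients\<close>

text \<open>As a function of \<open>t = x \<bullet> \<eta>\<close>, so that \<open>arccos t\<close> is the geodesic distance
  \<^term>\<open>geodist x \<eta>\<close>.\<close>

definition G :: "nat \<Rightarrow> real \<Rightarrow> real \<Rightarrow> real" where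
  "G m \<epsilon> t = 2 ^ (2*m - 2) / real m *
     (\<Sum>\<^sub>\<infinity>n\<in>(UNIV::int set).
        inverse \<epsilon> / (1 + (inverse \<epsilon>)\<^sup>2 * (arccos t + 2 * pi * of_int n)\<^sup>2) ^ m)"

text \<open>The library's recursively defined \<^const>\<open>Stirling\<close> numbers satisfy the identity
  that characterises the Stirling numbers of the second kind.\<close>

lemma power_eq_sum_Stirling:
  "(u::real) ^ k = (\<Sum>\<nu>=0..k. real (Stirling k \<nu>) * (\<Prod>i<\<nu>. u - real i))"
proof (induction k)
  case 0
  then show ?case by simp
next
  case (Suc k)
  let ?f = "\<lambda>\<nu>. \<Prod>i<\<nu>. u - real i"
  have step: "u * ?f \<nu> = ?f (Suc \<nu>) + real \<nu> * ?f \<nu>" for \<nu>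
    by (simp add: algebra_simps)
  have "u ^ Suc k = (\<Sum>\<nu>=0..k. real (Stirling k \<nu>) * (u * ?f \<nu>))"
    by (simp add: Suc sum_distrib_left mult_ac)
  also have "\<dots> = (\<Sum>\<nu>=0..k. real (Stirling k \<nu>) * ?f (Suc \<nu>))
                + (\<Sum>\<nu>=0..k. real (Stirling k \<nu>) * real \<nu> * ?f \<nu>)"
    unfolding step by (simp only: distrib_left sum.distrib mult.assoc)
  also have "(\<Sum>\<nu>=0..k. real (Stirling k \<nu>) * real \<nu> * ?f \<nu>)
           = (\<Sum>\<nu>=0..Suc k. real (Stirling k \<nu>) * real \<nu> * ?f \<nu>)"
    by simp
  also have "\<dots> = (\<Sum>\<nu>=0..k. real (Stirling k (Suc \<nu>)) * real (Suc \<nu>) * ?f (Suc \<nu>))"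
    by (subst sum.atLeast0_atMost_Suc_shift) simp
  also have "(\<Sum>\<nu>=0..k. real (Stirling k \<nu>) * ?f (Suc \<nu>)) + \<dots>
           = (\<Sum>\<nu>=0..k. real (Stirling (Suc k) (Suc \<nu>)) * ?f (Suc \<nu>))"
    unfolding sum.distrib [symmetric]
    by (rule sum.cong) (simp_all del: prod.lessThan_Suc add: algebra_simps)
  also have "\<dots> = (\<Sum>\<nu>=0..Suc k. real (Stirling (Suc k) \<nu>) * ?f \<nu>)"
    by (subst sum.atLeast0_atMost_Suc_shift) simp
  finally show ?case .
qed

definition A :: "nat \<Rightarrow> nat \<Rightarrow> real" where
  "A k l = (\<Sum>\<nu>=l..k. (-1) ^ (\<nu> - l) * real (\<nu> choose l) * fact \<nu> * real (Stirling k \<nu>))"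

definition Q :: "nat \<Rightarrow> nat \<Rightarrow> real \<Rightarrow> real" where
  "Q m l u = (\<Sum>k=l..m. real l * fact (2*m - k - 1) / (fact m * fact (m - k))
                 * (A (k - 1) (l - 1) / fact (k - 1)) * u ^ (k - l))"

definition H :: "nat \<Rightarrow> real \<Rightarrow> real^2 \<Rightarrow> real^2 \<Rightarrow> real" where
  "H m \<epsilon> \<eta> x = (let a = exp \<epsilon> in
     - (1/2) * (fact (2*m - 2) / (fact m * fact (m - 1)))
     + (\<Sum>l=1..m. Q m l (2*\<epsilon>) * ((2*\<epsilon>) ^ (l - 1) * a ^ l / fact l)
          * (dir_deriv \<eta> ^^ l) (\<lambda>y. ln (1 / norm (y - a *\<^sub>R \<eta>))) x))"

end

theory Submission
  imports Defs "HOL-Complex_Analysis.Complex_Analysis"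
begin

text \<open>
  Identify the plane with \<open>\<complex>\<close>, put \<open>m = n + 1\<close>, \<open>\<rho> = arccos (x \<bullet> \<eta>)\<close> and \<open>z = \<epsilon> + \<i>\<rho>\<close>. With
  \<open>p = 1 / (1 + \<i>s)\<close> and \<open>q = 1 / (1 - \<i>s)\<close> one has \<open>1 / (1 + s\<^sup>2) = p q\<close> and \<open>p + q = 2 p q\<close>, and
  an identity for partial binomial sums turns \<open>(p q)\<^sup>m\<close> into a linear combination of the
  \<open>p\<^sup>k + q\<^sup>k\<close>, \<open>1 \<le> k \<le> m\<close> (\<open>power_prod_partial_fractions\<close>). The kernel thus becomes a
  combination of the real parts of the series of \<open>1 / (z + 2\<pi>\<i>j)\<^sup>k\<close> over \<open>j \<in> \<int>\<close>, summed
  symmetrically. These are evaluated in closed form by \<open>Lipschitz_summation\<close>: for \<open>k = 1\<close> the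
  value is \<open>u - 1/2\<close> with \<open>u = 1 / (1 - exp (-z))\<close>, which is the reflection formula of the digamma
  function, and differentiation in \<open>z\<close> gives the other \<open>k\<close>, since the polynomials in \<open>u\<close> that arise
  satisfy the recurrence of the Stirling numbers. So the kernel is the real part of a
  polynomial in \<open>u\<close> with real coefficients, \<open>kernel_poly\<close>.

  On the other side, \<open>(\<eta> \<bullet> \<nabla>)\<^sup>l\<close> of the logarithmic potential is \<open>(l - 1)!\<close> times the real part of
  \<open>(\<eta> / (a\<eta> - x))\<^sup>l\<close>; expanding the same polynomial in powers of \<open>u\<close>, which brings in the
  coefficients \<^const>\<open>A\<close>, shows that \<^const>\<open>H\<close> is the real part of \<open>kernel_poly\<close> at
  \<open>u = a\<eta> / (a\<eta> - x)\<close>. This is a holomorphic function of \<open>x \<noteq> a\<eta>\<close>, hence \<^const>\<open>H\<close> is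
  harmonic there. On the unit circle the two values of \<open>u\<close> agree up to conjugation, which does
  not affect the real part, so that \<^const>\<open>G\<close> and \<^const>\<open>H\<close> coincide. The integral is then
  \<open>2\<pi>\<close> times the value of \<^const>\<open>H\<close> at the centre (\<open>u = 1\<close>), by the mean value property. The upper
  bound holds term by term: the term with index \<open>j\<close> is at most a constant times \<open>1 / j\<^sup>2\<close>
  (times \<open>1\<close> for \<open>j = 0\<close>) times the claimed majorant.
\<close>

section \<open>Summation of inverse powers over the integers\<close>

lemma Re_of_real_times: "Re (of_real r * w) = r * Re w"
  by simp

text \<open>For \<open>u = 1 / (1 - w)\<close> and \<open>\<bar>w\<bar> < 1\<close>, \<open>Phi k u\<close> is the sum of the series of \<open>j\<^sup>k w\<^sup>j\<close> over
  \<open>j \<ge> 0\<close> (with \<open>0\<^sup>0 = 1\<close>), written as a polynomial in \<open>u\<close>.\<close>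

definition Phi :: "nat \<Rightarrow> complex \<Rightarrow> complex" where
  "Phi k u = (\<Sum>\<nu>\<le>k. of_nat (Stirling k \<nu>) * fact \<nu> * ((u - 1) ^ \<nu> * u))"

lemma Phi_0 [simp]: "Phi 0 u = u"
  by (simp add: Phi_def)

lemma Phi_at_1: "Phi k 1 = (if k = 0 then 1 else 0)"
  unfolding Phi_def by (cases k) (auto intro!: sum.neutral simp: power_0_left)

text \<open>Expanding the powers of \<open>u - 1\<close> produces the coefficients \<^const>\<open>A\<close>.\<close>

lemma Phi_conv_A: "Phi k u = (\<Sum>l\<le>k. of_real (A k l) * u ^ Suc l)"
proof -
  have restr: "{l. l \<le> k \<and> l \<le> \<nu>} = {..\<nu>}" if "\<nu> \<le> k" for \<nu>
    using that by auto
  have restr': "{\<nu>. \<nu> \<le> k \<and> l \<le> \<nu>} = {l..k}" for l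
    by auto
  have "Phi k u = (\<Sum>\<nu>\<le>k. \<Sum>l\<le>\<nu>. of_nat (Stirling k \<nu>) * fact \<nu> * of_nat (\<nu> choose l) * (-1) ^ (\<nu> - l) * u ^ Suc l)"
    unfolding Phi_def
  proof (intro sum.cong refl)
    fix \<nu>
    have "(u - 1) ^ \<nu> = (\<Sum>l\<le>\<nu>. of_nat (\<nu> choose l) * u ^ l * (-1) ^ (\<nu> - l))"
      using binomial_ring[of u "-1" \<nu>] by simp
    then show "of_nat (Stirling k \<nu>) * fact \<nu> * ((u - 1) ^ \<nu> * u) =
      (\<Sum>l\<le>\<nu>. of_nat (Stirling k \<nu>) * fact \<nu> * of_nat (\<nu> choose l) * (-1) ^ (\<nu> - l) * u ^ Suc l)"
      by (simp add: sum_distrib_left sum_distrib_right mult_ac)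
  qed
  also have "\<dots> = (\<Sum>l\<le>k. \<Sum>\<nu>=l..k. of_nat (Stirling k \<nu>) * fact \<nu> * of_nat (\<nu> choose l) * (-1) ^ (\<nu> - l) * u ^ Suc l)"
    using sum.swap_restrict[of "{..k}" "{..k}" "\<lambda>\<nu> l. of_nat (Stirling k \<nu>) * fact \<nu> * of_nat (\<nu> choose l) * (-1) ^ (\<nu> - l) * u ^ Suc l" "\<lambda>\<nu> l. l \<le> \<nu>"]
    by (simp add: restr restr' cong: sum.cong_simp)
  also have "\<dots> = (\<Sum>l\<le>k. of_real (A k l) * u ^ Suc l)"
    by (intro sum.cong refl) (simp add: A_def sum_distrib_left sum_distrib_right mult_ac)
  finally show ?thesis .
qed

text \<open>The hypothesis is the differential equation of \<open>u = 1 / (1 - exp (- c x))\<close>. Under it,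
  differentiating \<^const>\<open>Phi\<close> reproduces the recurrence of the Stirling numbers.\<close>

lemma has_field_derivative_Phi:
  assumes "(u has_field_derivative c * (u x - (u x)\<^sup>2)) (at x)"
  shows "((\<lambda>x. Phi k (u x)) has_field_derivative - c * Phi (Suc k) (u x)) (at x)"
proof -
  let ?u = "u x" and ?d = "c * (u x - (u x)\<^sup>2)"
  have d: "((\<lambda>x. (u x - 1) ^ \<nu> * u x) has_field_derivative
        - c * (of_nat \<nu> * ((?u - 1) ^ \<nu> * ?u) + of_nat (Suc \<nu>) * ((?u - 1) ^ Suc \<nu> * ?u))) (at x)" for \<nu>
  proof (cases \<nu>)
    case 0
    then show ?thesis
      using assms by (simp add: algebra_simps power2_eq_square)
  next
    case (Suc n)
    have "((\<lambda>x. u x - 1) has_field_derivative ?d) (at x)"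
      using DERIV_diff[OF assms DERIV_const[of 1]] by simp
    from DERIV_mult[OF DERIV_power[OF this, of "Suc n"] assms]
    show ?thesis unfolding Suc
      by (rule DERIV_cong) (simp add: algebra_simps power2_eq_square)
  qed
  have "((\<lambda>x. Phi k (u x)) has_field_derivative
     (\<Sum>\<nu>\<le>k. of_nat (Stirling k \<nu>) * fact \<nu> * (- c * (of_nat \<nu> * ((?u - 1) ^ \<nu> * ?u) + of_nat (Suc \<nu>) * ((?u - 1) ^ Suc \<nu> * ?u))))) (at x)"
    unfolding Phi_def by (intro DERIV_sum DERIV_cmult d)
  also have "(\<Sum>\<nu>\<le>k. of_nat (Stirling k \<nu>) * fact \<nu> * (- c * (of_nat \<nu> * ((?u - 1) ^ \<nu> * ?u) + of_nat (Suc \<nu>) * ((?u - 1) ^ Suc \<nu> * ?u))))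
     = - c * ((\<Sum>\<nu>\<le>k. of_nat (\<nu> * Stirling k \<nu>) * fact \<nu> * ((?u - 1) ^ \<nu> * ?u))
        + (\<Sum>\<nu>\<le>k. of_nat (Stirling k \<nu>) * fact (Suc \<nu>) * ((?u - 1) ^ Suc \<nu> * ?u)))"
    by (simp add: sum_distrib_left sum.distrib[symmetric] algebra_simps del: power_Suc)
  also have "(\<Sum>\<nu>\<le>k. of_nat (\<nu> * Stirling k \<nu>) * fact \<nu> * ((?u - 1) ^ \<nu> * ?u))
      = (\<Sum>\<nu>\<le>Suc k. of_nat (\<nu> * Stirling k \<nu>) * fact \<nu> * ((?u - 1) ^ \<nu> * ?u))"
    by simp
  also have "\<dots> = (\<Sum>\<nu>\<le>k. of_nat (Suc \<nu> * Stirling k (Suc \<nu>)) * fact (Suc \<nu>) * ((?u - 1) ^ (Suc \<nu>) * ?u))"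
    by (subst sum.atMost_Suc_shift) simp
  also have "\<dots> + (\<Sum>\<nu>\<le>k. of_nat (Stirling k \<nu>) * fact (Suc \<nu>) * ((?u - 1) ^ Suc \<nu> * ?u))
      = (\<Sum>\<nu>\<le>k. of_nat (Stirling (Suc k) (Suc \<nu>)) * fact (Suc \<nu>) * ((?u - 1) ^ (Suc \<nu>) * ?u))"
    unfolding sum.distrib[symmetric]
    by (intro sum.cong refl) (simp add: algebra_simps del: power_Suc fact_Suc)
  also have "\<dots> = Phi (Suc k) ?u"
    unfolding Phi_def sum.atMost_Suc_shift[of _ k] by simp
  finally show ?thesis .
qed

lemma exp_eq_1_iff_Ints: "exp (- (2 * pi * \<i> * z)) = 1 \<longleftrightarrow> (z::complex) \<in> \<int>"
proof
  assume "exp (- (2 * pi * \<i> * z)) = 1"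
  then obtain n :: int where "Im z = 0" "- (2 * pi * Re z) = of_int (2 * n) * pi"
    unfolding exp_eq_1 by auto
  then have "pi * (- Re z) = pi * of_int n" by simp
  with \<open>Im z = 0\<close> have "z = of_int (- n)"
    unfolding mult_cancel_left by (auto simp: complex_eq_iff)
  then show "z \<in> \<int>" by (metis Ints_of_int)
next
  assume "z \<in> \<int>"
  then obtain n where "z = of_int n" by (auto elim: Ints_cases)
  then show "exp (- (2 * pi * \<i> * z)) = 1"
    unfolding exp_eq_1 by (auto intro!: exI[of _ "-n"])
qed

lemma complex_notin_Ints:
  assumes "(z::complex) \<notin> \<int>"
  shows "z \<notin> \<int>\<^sub>\<le>\<^sub>0" "1 - z \<notin> \<int>\<^sub>\<le>\<^sub>0" "z \<noteq> 0" "1 - z \<noteq> 0" "z + of_int n \<noteq> 0"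
proof -
  have *: "1 - z \<in> \<int> \<Longrightarrow> z \<in> \<int>"
    by (metis Ints_1 Ints_diff diff_diff_eq2 add_diff_cancel_left')
  have "z = of_int (-n)" if "z + of_int n = 0"
    using that by (simp add: add_eq_0_iff2)
  then show "z + of_int n \<noteq> 0" using assms by (metis Ints_of_int)
  show "z \<notin> \<int>\<^sub>\<le>\<^sub>0" "1 - z \<notin> \<int>\<^sub>\<le>\<^sub>0" "z \<noteq> 0" "1 - z \<noteq> 0"
    using assms * nonpos_Ints_subset_Ints Ints_0 by (metis subsetD)+
qed

text \<open>The logarithmic derivative of Euler's reflection formula for the Gamma function; the right
  hand side is \<open>\<pi> cot (\<pi> z)\<close>.\<close>

lemma Digamma_reflection:
  assumes "(z::complex) \<notin> \<int>"
  shows "Digamma (1 - z) - Digamma z = 2 * pi * \<i> * (1 / (1 - exp (- (2 * pi * \<i> * z))) - 1/2)"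
proof -
  note nz = complex_notin_Ints[OF assms]
  define e where "e = exp (pi * \<i> * z)"
  have e: "e \<noteq> 0" by (simp add: e_def)
  have e2: "exp (- (2 * pi * \<i> * z)) = 1 / e^2"
    by (simp add: e_def exp_minus field_simps exp_double[symmetric])
  have e2ne: "e^2 \<noteq> 1"
    using assms exp_eq_1_iff_Ints[of z] e e2 by auto
  have einv: "exp (- (\<i> * (pi * z))) = inverse e" "exp (\<i> * (pi * z)) = e"
    unfolding exp_minus by (simp_all add: e_def mult_ac)
  have s: "sin (pi * z) = (e - 1/e) / (2*\<i>)"
    unfolding sin_exp_eq einv by (simp add: inverse_eq_divide)
  have c: "cos (pi * z) = (e + 1/e) / 2"
    unfolding cos_exp_eq einv by (simp add: inverse_eq_divide)
  have sne: "sin (pi * z) \<noteq> 0"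
    unfolding s using e e2ne by (simp add: field_simps power2_eq_square)
  have "((\<lambda>z. Gamma z * Gamma (1 - z)) has_field_derivative
      (Gamma z * Gamma (1 - z) * (Digamma z - Digamma (1 - z)))) (at z)"
    using nz by (auto intro!: derivative_eq_intros simp: algebra_simps)
  moreover have "((\<lambda>z. Gamma z * Gamma (1 - z)) has_field_derivative
      (- (pi * pi * cos (pi * z)) / (sin (pi * z))\<^sup>2)) (at z)"
    unfolding Gamma_reflection_complex using sne
    by (auto intro!: derivative_eq_intros simp: power2_eq_square)
  ultimately have "Gamma z * Gamma (1 - z) * (Digamma z - Digamma (1 - z)) = - (pi * pi * cos (pi * z)) / (sin (pi * z))\<^sup>2"
    by (rule DERIV_unique)
  then have eq: "pi / sin (pi * z) * (Digamma z - Digamma (1 - z)) = - (pi * pi * cos (pi * z)) / (sin (pi * z))\<^sup>2"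
    unfolding Gamma_reflection_complex .
  have "complex_of_real pi * (sin (pi * z) * (Digamma (1 - z) - Digamma z))
      = - (pi / sin (pi * z) * (Digamma z - Digamma (1 - z))) * (sin (pi * z))\<^sup>2"
    using sne by (simp add: field_simps power2_eq_square)
  also have "\<dots> = pi * (pi * cos (pi * z))"
    unfolding eq using sne by simp
  finally have "complex_of_real pi * (sin (pi * z) * (Digamma (1 - z) - Digamma z)) = pi * (pi * cos (pi * z))" .
  then have "Digamma (1 - z) - Digamma z = pi * cos (pi * z) / sin (pi * z)"
    using sne unfolding mult_cancel_left by (simp add: field_simps)
  also have "\<dots> = 2 * pi * \<i> * (1 / (1 - exp (- (2 * pi * \<i> * z))) - 1/2)"
    unfolding s c e2 using e e2ne by (simp add: divide_simps power2_eq_square) (auto simp: algebra_simps)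
  finally show ?thesis .
qed

text \<open>The \<open>k\<close>-th derivative of the previous identity.\<close>

lemma Polygamma_reflection:
  assumes "(z::complex) \<notin> \<int>"
  shows "(-1) ^ k * Polygamma k (1 - z) - Polygamma k z =
    (-1) ^ k * (2 * pi * \<i>) ^ Suc k * (Phi k (1 / (1 - exp (- (2 * pi * \<i> * z)))) - (if k = 0 then 1/2 else 0))"
  using assms
proof (induction k arbitrary: z)
  case 0
  then show ?case using Digamma_reflection[of z] by simp
next
  case (Suc k)
  define c where "c = 2 * pi * \<i>"
  let ?u = "\<lambda>z::complex. 1 / (1 - exp (- (c * z)))"
  note nz = complex_notin_Ints[OF Suc.prems]
  have "open (- \<int> :: complex set)" using closed_Ints by blast
  have ne: "exp (- (c * z)) \<noteq> 1" using Suc.prems exp_eq_1_iff_Ints[of z] by (simp add: c_def)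
  have "(?u has_field_derivative c * (?u z - (?u z)\<^sup>2)) (at z)"
    using ne by (auto intro!: derivative_eq_intros simp: divide_simps power2_eq_square)
  from DERIV_diff[OF has_field_derivative_Phi[OF this, of k] DERIV_const[of "if k = 0 then 1/2 else 0"]]
  have "((\<lambda>z. (-1) ^ k * c ^ Suc k * (Phi k (?u z) - (if k = 0 then 1/2 else 0))) has_field_derivative
      (-1) ^ k * c ^ Suc k * (- c * Phi (Suc k) (?u z))) (at z)"
    by (intro DERIV_cmult) simp
  then have "((\<lambda>z. (-1) ^ k * Polygamma k (1 - z) - Polygamma k z) has_field_derivative
      (-1) ^ k * c ^ Suc k * (- c * Phi (Suc k) (?u z))) (at z)"
    by (rule has_field_derivative_transform_within_open[OF _ \<open>open (- \<int>)\<close>])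
       (use Suc in \<open>auto simp: c_def\<close>)
  moreover have "((\<lambda>z. (-1) ^ k * Polygamma k (1 - z) - Polygamma k z) has_field_derivative
      ((-1) ^ k * (- Polygamma (Suc k) (1 - z)) - Polygamma (Suc k) z)) (at z)"
    using nz by (auto intro!: derivative_eq_intros)
  ultimately have "(-1) ^ k * c ^ Suc k * (- c * Phi (Suc k) (?u z)) = (-1) ^ k * (- Polygamma (Suc k) (1 - z)) - Polygamma (Suc k) z"
    by (rule DERIV_unique)
  then show ?case by (simp add: c_def mult_ac)
qed

lemma sum_int_symmetric:
  fixes f :: "int \<Rightarrow> 'a::comm_monoid_add"
  shows "(\<Sum>n\<in>{- int N..<int N}. f n) = (\<Sum>n<N. f (int n)) + (\<Sum>n<N. f (- 1 - int n))"
proof (induction N)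
  case (Suc N)
  have "{- int (Suc N)..<int (Suc N)} = insert (int N) (insert (-1 - int N) {- int N..<int N})"
    by auto
  then show ?case using Suc by (simp add: add_ac)
qed simp

text \<open>The interval is symmetric under \<open>j \<mapsto> -1 - j\<close>; for \<open>k = 0\<close> the series does not converge
  absolutely, and the logarithms in the limit formula for the digamma function cancel between
  the two halves.\<close>

lemma tendsto_sum_inverse_shift_power:
  assumes "(z::complex) \<notin> \<int>"
  shows "(\<lambda>N. \<Sum>n\<in>{- int N..<int N}. 1 / (z + of_int n) ^ Suc k) \<longlonglongrightarrow>
    (-1) ^ k / fact k * ((-1) ^ k * Polygamma k (1 - z) - Polygamma k z)"
proof -
  note nz = complex_notin_Ints[OF assms]
  have neg: "1 / (z + of_int (- 1 - int n)) ^ Suc k = - ((-1) ^ k) * inverse ((1 - z + of_nat n) ^ Suc k)" for n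
  proof -
    have "z + of_int (- 1 - int n) = - (1 - z + of_nat n)" by simp
    then show ?thesis by (simp only: power_minus[of "1 - z + of_nat n"]) (simp add: divide_simps)
  qed
  show ?thesis
  proof (cases k)
    case 0
    have "(\<lambda>N. (of_real (ln (real N)) - (\<Sum>n<N. inverse (1 - z + of_nat n))) - (of_real (ln (real N)) - (\<Sum>n<N. inverse (z + of_nat n))))
        \<longlonglongrightarrow> Digamma (1 - z) - Digamma z"
      by (intro tendsto_diff Digamma_LIMSEQ nz)
    then show ?thesis unfolding sum_int_symmetric neg unfolding 0
      by (simp add: sum_negf inverse_eq_divide)
  next
    case (Suc j)
    then have "k > 0" by simp
    have "(\<lambda>N. (\<Sum>n<N. inverse ((z + of_nat n) ^ Suc k)) + (- ((-1) ^ k)) * (\<Sum>n<N. inverse ((1 - z + of_nat n) ^ Suc k)))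
       \<longlonglongrightarrow> ((-1) ^ Suc k * Polygamma k z / fact k) + (- ((-1) ^ k)) * ((-1) ^ Suc k * Polygamma k (1 - z) / fact k)"
      by (intro tendsto_intros Polygamma_LIMSEQ[unfolded sums_def] nz \<open>k > 0\<close>)
    then show ?thesis unfolding sum_int_symmetric neg
      by (simp add: sum_distrib_left inverse_eq_divide field_simps)
  qed
qed

text \<open>Lipschitz's summation formula. The correction \<open>1/2\<close> for \<open>k = 0\<close> is due to the symmetric
  summation.\<close>

lemma Lipschitz_summation:
  assumes "Re z > 0"
  shows "(\<lambda>N. \<Sum>n\<in>{- int N..<int N}. 1 / (z + 2 * pi * \<i> * of_int n) ^ Suc k) \<longlonglongrightarrow>
     (Phi k (1 / (1 - exp (- z))) - (if k = 0 then 1/2 else 0)) / fact k"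
proof -
  define c where "c = 2 * pi * \<i>"
  have c: "c \<noteq> 0" by (simp add: c_def)
  have "z / c \<notin> \<int>"
  proof
    assume "z / c \<in> \<int>"
    then obtain n where "z / c = of_int n" by (auto elim: Ints_cases)
    then have "z = of_int n * c" using c by (simp add: field_simps)
    then show False using assms by (simp add: c_def)
  qed
  have e: "1 / ((z / c + of_int n) ^ Suc k * c ^ Suc k) = 1 / (z + c * of_int n) ^ Suc k" for n
  proof -
    have "z + c * of_int n = c * (z / c + of_int n)" using c by (simp add: field_simps)
    then show ?thesis by (simp only: power_mult_distrib) (simp add: mult_ac)
  qed
  from tendsto_divide[OF tendsto_sum_inverse_shift_power[OF \<open>z / c \<notin> \<int>\<close>, of k] tendsto_const[of "c ^ Suc k"]]
  have "(\<lambda>N. \<Sum>n\<in>{- int N..<int N}. 1 / (z + c * of_int n) ^ Suc k) \<longlonglongrightarrow>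
      (-1) ^ k / fact k * ((-1) ^ k * Polygamma k (1 - z/c) - Polygamma k (z/c)) / c ^ Suc k"
    using c by (simp add: sum_divide_distrib e del: power_Suc)
  also have "(-1) ^ k / fact k * ((-1) ^ k * Polygamma k (1 - z/c) - Polygamma k (z/c)) / c ^ Suc k
     = (Phi k (1 / (1 - exp (- z))) - (if k = 0 then 1/2 else 0)) / fact k"
    unfolding Polygamma_reflection[OF \<open>z / c \<notin> \<int>\<close>] c_def[symmetric] using c by simp
  finally show ?thesis by (simp only: c_def)
qed

section \<open>Closed form of the periodised kernel\<close>

text \<open>The two sums are the lower and the upper half of the binomial expansion of
  \<open>(s + t)\<^bsup>2n+1\<^esup>\<close>.\<close>

lemma sum_binomial_half_eq_1:
  fixes s t :: "'a::field_char_0"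
  assumes "s + t = 1"
  shows "(\<Sum>j\<le>n. of_nat (n + j choose j) * (s ^ j * t ^ Suc n + t ^ j * s ^ Suc n)) = 1"
proof -
  have half: "(\<Sum>j\<le>n. of_nat (n + j choose j) * x ^ j) * y ^ Suc n
      = (\<Sum>j\<le>n. of_nat (2 * n + 1 choose j) * x ^ j * y ^ (2 * n + 1 - j))"
    if "x + y = 1" for x y :: 'a
  proof -
    have partial: "(\<Sum>j\<le>n. of_nat (n + j choose j) * x ^ j) = (\<Sum>j\<le>n. of_nat (2 * n + 1 choose j) * x ^ j * y ^ (n - j))"
    proof -
      have 1: "of_nat n + of_nat (Suc n) = (of_nat (2 * n + 1) :: 'a)" by simp
      have 2: "of_nat j + of_nat (Suc n) - 1 = (of_nat (n + j) :: 'a)" for j by simp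
      show ?thesis
        using gbinomial_partial_sum_poly_xpos[of n "of_nat (Suc n)" x y]
        unfolding 1 2 that binomial_gbinomial[symmetric] by simp
    qed
    show ?thesis
      unfolding partial sum_distrib_right
    proof (intro sum.cong refl)
      fix j assume "j \<in> {..n}"
      then have "2 * n + 1 - j = (n - j) + Suc n" by auto
      then show "of_nat (2 * n + 1 choose j) * x ^ j * y ^ (n - j) * y ^ Suc n = of_nat (2 * n + 1 choose j) * x ^ j * y ^ (2 * n + 1 - j)"
        by (simp only: power_add mult.assoc)
    qed
  qed
  have "t + s = 1" using assms by (simp add: add.commute)
  let ?g = "\<lambda>j. of_nat (2 * n + 1 choose j) * s ^ j * t ^ (2 * n + 1 - j)"
  have "(\<Sum>j\<le>n. of_nat (n + j choose j) * (s ^ j * t ^ Suc n + t ^ j * s ^ Suc n))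
    = (\<Sum>j\<le>n. of_nat (n + j choose j) * s ^ j) * t ^ Suc n + (\<Sum>j\<le>n. of_nat (n + j choose j) * t ^ j) * s ^ Suc n"
    by (simp only: sum_distrib_right sum.distrib[symmetric] distrib_left mult.assoc)
  also have "\<dots> = (\<Sum>j\<le>n. ?g j) + (\<Sum>j\<le>n. of_nat (2 * n + 1 choose j) * t ^ j * s ^ (2 * n + 1 - j))"
    by (simp only: half[OF assms] half[OF \<open>t + s = 1\<close>])
  also have "(\<Sum>j\<le>n. of_nat (2 * n + 1 choose j) * t ^ j * s ^ (2 * n + 1 - j)) = (\<Sum>j\<in>{n<..2*n+1}. ?g j)"
  proof (rule sum.reindex_bij_witness[of _ "\<lambda>j. 2 * n + 1 - j" "\<lambda>j. 2 * n + 1 - j"])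
    fix j assume "j \<in> {..n}"
    then have "j \<le> 2 * n + 1" by simp
    from binomial_symmetric[OF this] \<open>j \<le> 2 * n + 1\<close>
    show "of_nat (2 * n + 1 choose (2 * n + 1 - j)) * s ^ (2 * n + 1 - j) * t ^ (2 * n + 1 - (2 * n + 1 - j)) = of_nat (2 * n + 1 choose j) * t ^ j * s ^ (2 * n + 1 - j)"
      by (simp add: mult_ac)
  qed auto
  also have "(\<Sum>j\<le>n. ?g j) + (\<Sum>j\<in>{n<..2*n+1}. ?g j) = (\<Sum>j\<le>2*n+1. ?g j)"
  proof -
    have "{..2*n+1} = {..n} \<union> {n<..2*n+1}" by auto
    then show ?thesis by (simp only:) (intro sum.union_disjoint[symmetric]; auto)
  qed
  also have "\<dots> = 1"
    using binomial_ring[of s t "2*n+1"] assms by simp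
  finally show ?thesis .
qed

text \<open>With \<open>s = 1 / (2p)\<close> and \<open>t = 1 / (2q)\<close> the hypothesis reads \<open>s + t = 1\<close>, and the claim is
  the preceding identity multiplied by \<open>(p q)\<^bsup>n+1\<^esup>\<close>.\<close>

lemma power_prod_partial_fractions:
  fixes p q :: "'a::field_char_0"
  assumes pq: "p + q = 2 * p * q" and "p \<noteq> 0" "q \<noteq> 0"
  shows "(p * q) ^ Suc n = (\<Sum>k\<le>n. of_nat (2 * n - k choose n) / 2 ^ (2 * n + 1 - k) * (p ^ Suc k + q ^ Suc k))"
proof -
  define s t where "s = 1 / (2 * p)" and "t = 1 / (2 * q)"
  have st: "s + t = 1"
  proof -
    have "s + t = (p + q) / (2 * p * q)" using assms by (simp add: s_def t_def field_simps)
    then show ?thesis using assms by simp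
  qed
  have ps: "p * s = 1/2" and qt: "q * t = 1/2" using assms by (simp_all add: s_def t_def)
  have aux: "(x * y) ^ Suc n * (v ^ j * w ^ Suc n) = x ^ Suc (n - j) / 2 ^ (n + 1 + j)"
    if "j \<le> n" and "x * v = 1/2" "y * w = 1/2" for x y v w :: 'a and j
  proof -
    have "x ^ Suc n = x ^ Suc (n - j) * x ^ j"
      unfolding power_add[symmetric] using that by simp
    then have "(x * y) ^ Suc n * (v ^ j * w ^ Suc n) = x ^ Suc (n - j) * (x * v) ^ j * (y * w) ^ Suc n"
      by (simp only: power_mult_distrib mult_ac)
    then show ?thesis unfolding that by (simp add: power_add field_simps)
  qed
  have "(p * q) ^ Suc n = (p * q) ^ Suc n * (\<Sum>j\<le>n. of_nat (n + j choose j) * (s ^ j * t ^ Suc n + t ^ j * s ^ Suc n))"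
    by (simp only: sum_binomial_half_eq_1[OF st] mult_1_right)
  also have "\<dots> = (\<Sum>j\<le>n. of_nat (n + j choose j) * ((p * q) ^ Suc n * (s ^ j * t ^ Suc n) + (q * p) ^ Suc n * (t ^ j * s ^ Suc n)))"
    unfolding sum_distrib_left
    by (intro sum.cong refl) (simp only: mult.commute[of q p] distrib_left mult.left_commute)
  also have "\<dots> = (\<Sum>j\<le>n. of_nat (n + j choose j) * (p ^ Suc (n - j) / 2 ^ (n + 1 + j) + q ^ Suc (n - j) / 2 ^ (n + 1 + j)))"
    by (intro sum.cong refl) (simp only: aux[OF _ ps qt] aux[OF _ qt ps] atMost_iff)
  also have "\<dots> = (\<Sum>k\<le>n. of_nat (2 * n - k choose n) / 2 ^ (2 * n + 1 - k) * (p ^ Suc k + q ^ Suc k))"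
  proof (rule sum.reindex_bij_witness[of _ "\<lambda>j. n - j" "\<lambda>j. n - j"])
    fix j assume "j \<in> {..n}"
    then have *: "2 * n - (n - j) = n + j" "2 * n + 1 - (n - j) = n + 1 + j" by auto
    have "n + j choose n = n + j choose j"
      using binomial_symmetric[of n "n + j"] by simp
    then show "of_nat (2 * n - (n - j) choose n) / 2 ^ (2 * n + 1 - (n - j)) * (p ^ Suc (n - j) + q ^ Suc (n - j))
       = of_nat (n + j choose j) * (p ^ Suc (n - j) / 2 ^ (n + 1 + j) + q ^ Suc (n - j) / 2 ^ (n + 1 + j))"
      unfolding * by (simp add: add_divide_distrib distrib_left del: power_Suc power_add)
  qed auto
  finally show ?thesis .
qed

lemma rational_kernel_partial_fractions:
  fixes \<epsilon> t :: real
  assumes "\<epsilon> > 0"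
  shows "1 / (1 + (inverse \<epsilon>)\<^sup>2 * t\<^sup>2) ^ Suc n =
    (\<Sum>k\<le>n. of_nat (2 * n - k choose n) / 2 ^ (2 * n - k) * \<epsilon> ^ Suc k * Re (1 / (of_real \<epsilon> + \<i> * of_real t) ^ Suc k))"
proof -
  define z where "z = complex_of_real \<epsilon> + \<i> * of_real t"
  have z: "z \<noteq> 0" using assms by (auto simp: z_def complex_eq_iff)
  have zz: "z * cnj z = of_real (\<epsilon>\<^sup>2 + t\<^sup>2)" by (simp add: z_def complex_eq_iff power2_eq_square)
  have pos: "\<epsilon>\<^sup>2 + t\<^sup>2 > 0" using assms by (simp add: add_pos_nonneg)
  define p where "p = of_real \<epsilon> / z"
  have cp: "cnj p = of_real \<epsilon> / cnj z" by (simp add: p_def)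
  have p: "p \<noteq> 0" "cnj p \<noteq> 0" using assms z by (simp_all add: p_def)
  have "p * cnj p = of_real (\<epsilon>\<^sup>2 / (\<epsilon>\<^sup>2 + t\<^sup>2))"
    unfolding cp unfolding p_def times_divide_times_eq zz by (simp add: power2_eq_square)
  also have "\<epsilon>\<^sup>2 / (\<epsilon>\<^sup>2 + t\<^sup>2) = 1 / (1 + (inverse \<epsilon>)\<^sup>2 * t\<^sup>2)"
    using assms pos by (simp add: field_simps)
  finally have pq: "p * cnj p = of_real (1 / (1 + (inverse \<epsilon>)\<^sup>2 * t\<^sup>2))" .
  have "p + cnj p = of_real \<epsilon> * (z + cnj z) / (z * cnj z)"
    unfolding cp using z by (simp add: p_def field_simps)
  also have "z + cnj z = 2 * of_real \<epsilon>" by (simp add: z_def complex_eq_iff)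
  finally have sum: "p + cnj p = 2 * p * cnj p" by (simp add: cp p_def)
  have "complex_of_real (1 / (1 + (inverse \<epsilon>)\<^sup>2 * t\<^sup>2) ^ Suc n) = (p * cnj p) ^ Suc n"
    unfolding pq by (simp add: power_divide)
  also have "\<dots> = (\<Sum>k\<le>n. of_nat (2 * n - k choose n) / 2 ^ (2 * n + 1 - k) * (p ^ Suc k + cnj p ^ Suc k))"
    by (rule power_prod_partial_fractions) (use p sum in auto)
  also have "\<dots> = of_real (\<Sum>k\<le>n. of_nat (2 * n - k choose n) / 2 ^ (2 * n - k) * \<epsilon> ^ Suc k * Re (1 / z ^ Suc k))"
    unfolding of_real_sum
  proof (intro sum.cong refl)
    fix k assume "k \<in> {..n}"
    then have s: "2 * n + 1 - k = Suc (2 * n - k)" by auto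
    have "p ^ Suc k = of_real (\<epsilon> ^ Suc k) * (1 / z ^ Suc k)"
      by (simp add: p_def power_divide)
    then have "Re (p ^ Suc k) = \<epsilon> ^ Suc k * Re (1 / z ^ Suc k)"
      by (simp only: Re_of_real_times)
    then have "p ^ Suc k + cnj p ^ Suc k = of_real (2 * (\<epsilon> ^ Suc k * Re (1 / z ^ Suc k)))"
      unfolding complex_cnj_power[symmetric] by (simp only: complex_add_cnj)
    then show "of_nat (2 * n - k choose n) / 2 ^ (2 * n + 1 - k) * (p ^ Suc k + cnj p ^ Suc k) =
       complex_of_real (of_nat (2 * n - k choose n) / 2 ^ (2 * n - k) * \<epsilon> ^ Suc k * Re (1 / z ^ Suc k))"
      unfolding s by (simp only:) simp
  qed
  finally show ?thesis unfolding of_real_eq_iff z_def .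
qed

lemma has_sum_imp_symmetric_limit:
  fixes f :: "int \<Rightarrow> 'a::topological_comm_monoid_add"
  assumes "(f has_sum S) UNIV"
  shows "(\<lambda>N. \<Sum>n\<in>{- int N..<int N}. f n) \<longlonglongrightarrow> S"
proof -
  have "filterlim (\<lambda>N. {- int N..<int N}) (finite_subsets_at_top UNIV) sequentially"
    unfolding filterlim_finite_subsets_at_top
  proof (intro allI impI)
    fix X :: "int set" assume "finite X \<and> X \<subseteq> UNIV"
    then obtain B where "abs ` X \<subseteq> {..B}"
      unfolding finite_int_iff_bounded_le by blast
    then have B: "\<bar>x\<bar> \<le> B" if "x \<in> X" for x using that by auto
    have "\<forall>\<^sub>F N in sequentially. nat (B + 1) \<le> N" by (rule eventually_ge_at_top)
    then show "\<forall>\<^sub>F N in sequentially. finite {- int N..<int N} \<and> X \<subseteq> {- int N..<int N} \<and> {- int N..<int N} \<subseteq> UNIV"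
    proof eventually_elim
      case (elim N)
      have "x \<in> {- int N..<int N}" if "x \<in> X" for x
        using B[OF that] elim by auto
      then have "X \<subseteq> {- int N..<int N}" by blast
      then show ?case by simp
    qed
  qed
  with assms show ?thesis unfolding has_sum_def by (rule filterlim_compose)
qed

text \<open>The polynomial in \<open>u\<close> whose real part is the kernel of order \<open>m = n + 1\<close>; the index \<open>n\<close> avoids
  truncated subtraction.\<close>

definition kernel_poly :: "nat \<Rightarrow> real \<Rightarrow> complex \<Rightarrow> complex" where
  "kernel_poly n \<epsilon> u = (\<Sum>k\<le>n. of_real (fact (2 * n - k) / (fact (Suc n) * fact (n - k)) / fact k * (2 * \<epsilon>) ^ k)
      * (Phi k u - (if k = 0 then 1/2 else 0)))"

lemma kernel_series_eq:
  assumes "\<epsilon> > 0" and sm: "(\<lambda>j::int. inverse \<epsilon> / (1 + (inverse \<epsilon>)\<^sup>2 * (\<rho> + 2 * pi * of_int j)\<^sup>2) ^ Suc n) summable_on UNIV"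
  shows "2 ^ (2 * n) / real (Suc n) * (\<Sum>\<^sub>\<infinity>j\<in>(UNIV::int set). inverse \<epsilon> / (1 + (inverse \<epsilon>)\<^sup>2 * (\<rho> + 2 * pi * of_int j)\<^sup>2) ^ Suc n)
    = Re (kernel_poly n \<epsilon> (1 / (1 - exp (- (of_real \<epsilon> + \<i> * of_real \<rho>)))))"
proof -
  define z where "z = complex_of_real \<epsilon> + \<i> * of_real \<rho>"
  define u where "u = 1 / (1 - exp (- z))"
  define L where "L k = (Phi k u - (if k = 0 then 1/2 else 0)) / fact k" for k
  define c where "c k = 2 ^ (2 * n) / real (Suc n) * (of_nat (2 * n - k choose n) / 2 ^ (2 * n - k) * \<epsilon> ^ k)" for k
  let ?f = "\<lambda>j::int. inverse \<epsilon> / (1 + (inverse \<epsilon>)\<^sup>2 * (\<rho> + 2 * pi * of_int j)\<^sup>2) ^ Suc n"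
  have f: "2 ^ (2 * n) / real (Suc n) * ?f j = (\<Sum>k\<le>n. c k * Re (1 / (z + 2 * pi * \<i> * of_int j) ^ Suc k))" for j
  proof -
    have "of_real \<epsilon> + \<i> * of_real (\<rho> + 2 * pi * of_int j) = z + 2 * pi * \<i> * of_int j"
      by (simp add: z_def algebra_simps)
    then have "?f j = inverse \<epsilon> * (\<Sum>k\<le>n. of_nat (2 * n - k choose n) / 2 ^ (2 * n - k) * \<epsilon> ^ Suc k * Re (1 / (z + 2 * pi * \<i> * of_int j) ^ Suc k))"
      using rational_kernel_partial_fractions[OF assms(1), of "\<rho> + 2 * pi * of_int j" n] by (simp add: divide_inverse)
    also have "\<dots> = (\<Sum>k\<le>n. of_nat (2 * n - k choose n) / 2 ^ (2 * n - k) * \<epsilon> ^ k * Re (1 / (z + 2 * pi * \<i> * of_int j) ^ Suc k))"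
      unfolding sum_distrib_left using assms(1) by (intro sum.cong refl) simp
    finally show ?thesis
      unfolding c_def by (simp only: sum_distrib_left mult.assoc)
  qed
  have "(\<lambda>N. \<Sum>k\<le>n. c k * Re (\<Sum>j\<in>{- int N..<int N}. 1 / (z + 2 * pi * \<i> * of_int j) ^ Suc k)) \<longlonglongrightarrow> (\<Sum>k\<le>n. c k * Re (L k))"
    unfolding L_def u_def by (intro tendsto_intros Lipschitz_summation) (use assms in \<open>simp add: z_def\<close>)
  also have "(\<lambda>N. \<Sum>k\<le>n. c k * Re (\<Sum>j\<in>{- int N..<int N}. 1 / (z + 2 * pi * \<i> * of_int j) ^ Suc k))
     = (\<lambda>N. 2 ^ (2 * n) / real (Suc n) * (\<Sum>j\<in>{- int N..<int N}. ?f j))"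
    unfolding sum_distrib_left f Re_sum by (rule ext, rule sum.swap)
  finally have lim1: "(\<lambda>N. 2 ^ (2 * n) / real (Suc n) * (\<Sum>j\<in>{- int N..<int N}. ?f j)) \<longlonglongrightarrow> (\<Sum>k\<le>n. c k * Re (L k))" .
  have lim2: "(\<lambda>N. 2 ^ (2 * n) / real (Suc n) * (\<Sum>j\<in>{- int N..<int N}. ?f j)) \<longlonglongrightarrow> 2 ^ (2 * n) / real (Suc n) * infsum ?f UNIV"
    by (intro tendsto_mult_left has_sum_imp_symmetric_limit has_sum_infsum sm)
  have "(\<Sum>k\<le>n. c k * Re (L k)) = Re (kernel_poly n \<epsilon> u)"
    unfolding kernel_poly_def Re_sum
  proof (intro sum.cong refl)
    fix k assume "k \<in> {..n}"
    then have k: "k \<le> n" "n \<le> 2 * n - k" "2 * n = k + (2 * n - k)" "2 * n - k - n = n - k" by auto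
    define T :: real where "T = 2 ^ (2 * n - k)"
    have T: "T \<noteq> 0" "(2::real) ^ (2 * n) = 2 ^ k * T"
      using k(3) by (simp add: T_def, metis T_def power_add)
    have "c k / fact k = fact (2 * n - k) / (fact (Suc n) * fact (n - k)) / fact k * (2 * \<epsilon>) ^ k"
      unfolding c_def binomial_fact[OF k(2)] k(4) power_mult_distrib T_def[symmetric] T(2)
      using T(1) by (simp add: divide_simps)
    moreover have "c k * Re (L k) = c k / fact k * Re (Phi k u - (if k = 0 then 1/2 else 0))"
      unfolding L_def of_real_fact[where 'a = complex, symmetric] Re_divide_of_real by simp
    ultimately show "c k * Re (L k) = Re (of_real (fact (2 * n - k) / (fact (Suc n) * fact (n - k)) / fact k * (2 * \<epsilon>) ^ k) * (Phi k u - (if k = 0 then 1/2 else 0)))"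
      unfolding Re_of_real_times by simp
  qed
  with LIMSEQ_unique[OF lim1 lim2] show ?thesis unfolding u_def z_def by simp
qed

text \<open>A summable majorant, up to a factor, of the terms of the kernel.\<close>

definition inv_square_bound :: "int \<Rightarrow> real" where
  "inv_square_bound j = (if j = 0 then 1 else 1 / (of_int j)\<^sup>2)"

lemma inv_square_bound_pos: "inv_square_bound j > 0"
  by (simp add: inv_square_bound_def)

lemma inv_square_bound_summable: "inv_square_bound summable_on UNIV"
proof -
  let ?g = "\<lambda>n. if n = 0 then 1 else 1 / (real n)\<^sup>2"
  have "summable (\<lambda>n. 1 / (real (Suc n))\<^sup>2)"
    using summable_Suc_iff[of "\<lambda>n. 1 / (real n)\<^sup>2"] inverse_power_summable[of 2, where 'a=real]
    by (simp add: inverse_eq_divide)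
  then have s2: "(\<lambda>n. 1 / (real (Suc n))\<^sup>2) summable_on UNIV"
    by (subst summable_on_UNIV_nonneg_real_iff) auto
  from \<open>summable (\<lambda>n. 1 / (real (Suc n))\<^sup>2)\<close> have "summable ?g"
    by (subst summable_Suc_iff[symmetric]) simp
  then have s1: "?g summable_on UNIV"
    by (subst summable_on_UNIV_nonneg_real_iff) auto
  have 1: "inv_square_bound summable_on range int"
    by (subst summable_on_reindex) (use s1 in \<open>auto simp: o_def inv_square_bound_def cong: if_cong\<close>)
  have sq: "(- 1 - real n)\<^sup>2 = (1 + real n)\<^sup>2" for n
    by (simp add: power2_eq_square algebra_simps)
  have 2: "inv_square_bound summable_on range (\<lambda>n. - int (Suc n))"
    by (subst summable_on_reindex) (use s2 in \<open>simp_all add: inj_on_def o_def inv_square_bound_def sq\<close>)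
  have U: "(UNIV :: int set) = range int \<union> range (\<lambda>n. - int (Suc n))"
  proof (intro equalityI subsetI)
    fix j :: int
    show "j \<in> range int \<union> range (\<lambda>n. - int (Suc n))"
      by (cases j rule: int_cases) blast+
  qed simp
  show ?thesis unfolding U by (rule summable_on_Un_disjoint[OF 1 2]) auto
qed

text \<open>For \<open>s = \<rho> / \<epsilon>\<close> and \<open>w = (\<rho> + 2\<pi>j) / \<epsilon>\<close> the inequality reduces to
  \<open>b (1 + s)\<^sup>2 / 4 \<le> 1 + w\<^sup>2\<close> with \<open>b = max 1 j\<^sup>2\<close>. For \<open>j \<noteq> 0\<close> it follows from
  \<open>\<bar>w\<bar> \<ge> \<pi> \<bar>j\<bar> / \<epsilon>\<close> and \<open>1 + s \<le> 2\<pi> / \<epsilon>\<close>; this uses \<open>\<epsilon> \<le> 1\<close>.\<close>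

lemma kernel_term_bound:
  fixes \<epsilon> \<rho> :: real and j :: int
  assumes "0 < \<epsilon>" "\<epsilon> \<le> 1" "0 \<le> \<rho>" "\<rho> \<le> pi" "m \<ge> 1"
  shows "inverse \<epsilon> / (1 + (inverse \<epsilon>)\<^sup>2 * (\<rho> + 2 * pi * of_int j)\<^sup>2) ^ m
    \<le> 4 ^ m * (inverse \<epsilon> / (1 + inverse \<epsilon> * \<rho>) ^ (2 * m)) * inv_square_bound j"
proof -
  define s where "s = inverse \<epsilon> * \<rho>"
  define w where "w = inverse \<epsilon> * (\<rho> + 2 * pi * of_int j)"
  define b :: real where "b = (if j = 0 then 1 else (of_int j)\<^sup>2)"
  have s0: "s \<ge> 0" using assms by (simp add: s_def)
  have b1: "b \<ge> 1"
  proof (cases "j = 0")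
    case False
    then have "1 \<le> \<bar>j\<bar>" by linarith
    then have "1 \<le> j\<^sup>2" using one_le_power[of "\<bar>j\<bar>" 2] by simp
    then have "1 \<le> real_of_int (j\<^sup>2)" by linarith
    then show ?thesis using False by (simp add: b_def)
  qed (simp add: b_def)
  have key: "b * (1 + s)\<^sup>2 / 4 \<le> 1 + w\<^sup>2"
  proof (cases "j = 0")
    case True
    then have "w = s" by (simp add: w_def s_def)
    have "(1 + s)\<^sup>2 \<le> 4 * (1 + s\<^sup>2)"
      using sum_squares_ge_zero[of "s - 1" 0] s0 by (simp add: power2_eq_square algebra_simps)
    then show ?thesis using True \<open>w = s\<close> by (simp add: b_def)
  next
    case False
    have j1: "\<bar>real_of_int j\<bar> \<ge> 1" using False by linarith
    have "pi * \<bar>real_of_int j\<bar> \<ge> pi" using j1 by simp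
    have "\<bar>\<rho> + 2 * pi * of_int j\<bar> \<ge> 2 * pi * \<bar>of_int j\<bar> - \<rho>"
      using assms(3) abs_triangle_ineq2[of "2 * pi * of_int j" "-\<rho>"] by (simp add: abs_mult add.commute)
    then have "\<bar>\<rho> + 2 * pi * of_int j\<bar> \<ge> pi * \<bar>of_int j\<bar>"
      using \<open>pi * \<bar>real_of_int j\<bar> \<ge> pi\<close> assms(4) by linarith
    then have w: "\<bar>w\<bar> \<ge> inverse \<epsilon> * (pi * \<bar>of_int j\<bar>)"
      using assms(1) by (simp add: w_def abs_mult)
    have "1 + s \<le> 2 * (inverse \<epsilon> * pi)"
    proof -
      have "s \<le> inverse \<epsilon> * pi" using assms by (simp add: s_def)
      moreover have "1 * 1 \<le> inverse \<epsilon> * pi"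
        by (intro mult_mono) (use assms pi_gt3 in \<open>auto simp: one_le_inverse_iff\<close>)
      ultimately show ?thesis by simp
    qed
    then have "\<bar>of_int j\<bar> * (1 + s) / 2 \<le> inverse \<epsilon> * (pi * \<bar>of_int j\<bar>)"
      using mult_right_mono[of "1 + s" "2 * (inverse \<epsilon> * pi)" "\<bar>of_int j\<bar>"] by (simp add: mult_ac)
    with w have "\<bar>of_int j\<bar> * (1 + s) / 2 \<le> \<bar>w\<bar>" by linarith
    then have "(\<bar>of_int j\<bar> * (1 + s) / 2)\<^sup>2 \<le> \<bar>w\<bar>\<^sup>2"
      by (intro power_mono) (use s0 in auto)
    then show ?thesis using False by (simp add: b_def power_mult_distrib power_divide)
  qed
  have pos: "b * (1 + s)\<^sup>2 / 4 > 0" using b1 s0 by (auto intro!: divide_pos_pos mult_pos_pos)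
  have "b * ((1 + s) ^ (2 * m) / 4 ^ m) \<le> b ^ m * ((1 + s) ^ (2 * m) / 4 ^ m)"
    using self_le_power[OF b1, of m] assms(5) s0 by (intro mult_right_mono) auto
  also have "\<dots> = (b * (1 + s)\<^sup>2 / 4) ^ m"
    by (simp add: power_mult_distrib power_divide power_mult)
  also have "\<dots> \<le> (1 + w\<^sup>2) ^ m"
    using key pos by (intro power_mono) auto
  finally have *: "b * ((1 + s) ^ (2 * m) / 4 ^ m) \<le> (1 + w\<^sup>2) ^ m" .
  have "inverse \<epsilon> / (1 + w\<^sup>2) ^ m \<le> inverse \<epsilon> / (b * ((1 + s) ^ (2 * m) / 4 ^ m))"
    using * assms(1) b1 s0 by (intro divide_left_mono) (auto intro!: mult_pos_pos zero_less_power add_pos_nonneg divide_pos_pos)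
  also have "\<dots> = 4 ^ m * (inverse \<epsilon> / (1 + s) ^ (2 * m)) * inv_square_bound j"
    by (simp add: b_def inv_square_bound_def)
  finally show ?thesis by (simp add: w_def s_def power_mult_distrib)
qed

section \<open>Real parts of holomorphic functions on the plane\<close>

text \<open>The identification of the Euclidean plane with \<open>\<complex>\<close>.\<close>

definition to_complex :: "real^2 \<Rightarrow> complex" where
  "to_complex v = Complex (v $ 1) (v $ 2)"

lemma to_complex_sel [simp]: "Re (to_complex v) = v $ 1" "Im (to_complex v) = v $ 2"
  by (simp_all add: to_complex_def)

lemma norm_to_complex [simp]: "cmod (to_complex v) = norm v"
  by (simp add: cmod_def norm_vec_def L2_set_def sum_2)

lemma linear_to_complex: "linear to_complex"
  by (rule linearI) (simp_all add: complex_eq_iff)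

lemma bounded_linear_to_complex: "bounded_linear to_complex"
  using linear_to_complex by (simp add: linear_conv_bounded_linear)

lemma to_complex_simps [simp]:
  "to_complex (x + y) = to_complex x + to_complex y"
  "to_complex (x - y) = to_complex x - to_complex y"
  "to_complex (r *\<^sub>R x) = of_real r * to_complex x"
  by (simp_all add: complex_eq_iff)

lemma to_complex_inject: "to_complex x = to_complex y \<longleftrightarrow> x = y"
  by (simp add: complex_eq_iff vec_eq_iff forall_2)

lemma Re_to_complex_mult_cnj: "Re (to_complex x * cnj (to_complex y)) = x \<bullet> y"
  by (simp add: inner_vec_def sum_2)

lemma has_derivative_Re_to_complex:
  assumes "(h has_field_derivative d) (at (to_complex x))"
  shows "((\<lambda>y. Re (h (to_complex y))) has_derivative (\<lambda>v. Re (d * to_complex v))) (at x)"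
proof -
  have "(to_complex has_derivative to_complex) (at x)"
    using bounded_linear_to_complex by (rule bounded_linear_imp_has_derivative)
  from has_derivative_compose[OF this assms[THEN has_field_derivative_imp_has_derivative]]
  show ?thesis by (rule has_derivative_Re)
qed

text \<open>The representation of \<open>f\<close> is only needed near \<open>x\<close>, where it determines the directional
  derivative.\<close>

lemma dir_deriv_Re_to_complex:
  assumes "open S" "x \<in> S" and f: "\<And>y. y \<in> S \<Longrightarrow> f y = Re (h (to_complex y))"
    and "(h has_field_derivative d) (at (to_complex x))"
  shows "(f has_derivative (\<lambda>v. Re (d * to_complex v))) (at x)"
    and "dir_deriv v f x = Re (d * to_complex v)"
proof -
  show *: "(f has_derivative (\<lambda>v. Re (d * to_complex v))) (at x)"
    by (rule has_derivative_transform_within_open[OF has_derivative_Re_to_complex[OF assms(4)] assms(1,2)])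
       (simp add: f)
  have "((\<lambda>t. x + t *\<^sub>R v) has_derivative (\<lambda>t. t *\<^sub>R v)) (at 0)"
    by (auto intro!: derivative_eq_intros)
  from has_derivative_compose[OF this, of f "\<lambda>v. Re (d * to_complex v)"] *
  have "((\<lambda>t. f (x + t *\<^sub>R v)) has_derivative (\<lambda>t. Re (d * to_complex (t *\<^sub>R v)))) (at 0)"
    by simp
  moreover have "(\<lambda>t. Re (d * to_complex (t *\<^sub>R v))) = (*) (Re (d * to_complex v))"
    by (auto simp: algebra_simps)
  ultimately have "((\<lambda>t. f (x + t *\<^sub>R v)) has_field_derivative Re (d * to_complex v)) (at 0)"
    by (simp only: has_field_derivative_def)
  then show "dir_deriv v f x = Re (d * to_complex v)"
    unfolding dir_deriv_def by (rule DERIV_imp_deriv)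
qed

lemma harmonic_on_Re_holomorphic:
  assumes "open S" "open T" and h: "h holomorphic_on T" and ST: "to_complex ` S \<subseteq> T"
    and f: "\<And>y. y \<in> S \<Longrightarrow> f y = Re (h (to_complex y))"
  shows "harmonic_on f S"
proof -
  have T: "to_complex y \<in> T" if "y \<in> S" for y using that ST by auto
  have h1: "deriv h holomorphic_on T" and h2: "deriv (deriv h) holomorphic_on T"
    using h \<open>open T\<close> by (auto intro!: holomorphic_deriv)
  have d0: "(h has_field_derivative deriv h w) (at w)" if "w \<in> T" for w
    using holomorphic_derivI[OF h \<open>open T\<close> that] .
  have d1: "((\<lambda>w. deriv h w * c) has_field_derivative deriv (deriv h) w * c) (at w)" if "w \<in> T" for w c
    using DERIV_cmult_right[OF holomorphic_derivI[OF h1 \<open>open T\<close> that]] .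
  have D1: "dir_deriv i f y = Re (deriv h (to_complex y) * to_complex i)" if "y \<in> S" for y i
    using dir_deriv_Re_to_complex(2)[OF \<open>open S\<close> that f d0[OF T[OF that]]] .
  have D2: "dir_deriv j (dir_deriv i f) y = Re (deriv (deriv h) (to_complex y) * to_complex i * to_complex j)" if "y \<in> S" for y i j
    using dir_deriv_Re_to_complex(2)[OF \<open>open S\<close> that D1 d1[OF T[OF that]]] .
  have "f differentiable_on S"
    using dir_deriv_Re_to_complex(1)[OF \<open>open S\<close> _ f d0[OF T]]
    by (auto simp: differentiable_on_eq_differentiable_at[OF \<open>open S\<close>] differentiable_def)
  moreover have "dir_deriv i f differentiable_on S" for i
    using dir_deriv_Re_to_complex(1)[OF \<open>open S\<close> _ D1 d1[OF T]]
    by (auto simp: differentiable_on_eq_differentiable_at[OF \<open>open S\<close>] differentiable_def)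
  moreover have "continuous_on S (dir_deriv j (dir_deriv i f))" for i j
  proof -
    have "continuous_on S (\<lambda>y. Re (deriv (deriv h) (to_complex y) * to_complex i * to_complex j))"
      by (intro continuous_intros continuous_on_compose2[OF holomorphic_on_imp_continuous_on[OF h2]]
            linear_continuous_on bounded_linear_to_complex ST)
    then show ?thesis by (rule continuous_on_eq) (simp add: D2)
  qed
  moreover have "laplacian f x = 0" if "x \<in> S" for x
  proof -
    have B: "(Basis :: (real^2) set) = {axis 1 1, axis 2 1}"
      by (auto simp: Basis_vec_def UNIV_2)
    have "axis 1 1 \<noteq> (axis 2 1 :: real^2)" by (simp add: axis_eq_axis)
    moreover have "to_complex (axis 1 1) = 1" "to_complex (axis 2 1) = \<i>"
      by (simp_all add: complex_eq_iff axis_def)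
    ultimately show ?thesis unfolding laplacian_def B by (simp add: D2[OF that] del: to_complex_sel)
  qed
  ultimately show ?thesis using \<open>open S\<close> by (simp add: harmonic_on_def)
qed

text \<open>The logarithm has no holomorphic branch on the whole punctured plane, but the first directional
  derivative is local and its formula is global, so all further ones follow by differentiating a
  rational function.\<close>

lemma dir_deriv_funpow_ln_norm:
  assumes "y \<noteq> b *\<^sub>R \<eta>" and "p = to_complex \<eta>"
  shows "(dir_deriv \<eta> ^^ Suc l) (\<lambda>y. ln (1 / norm (y - b *\<^sub>R \<eta>))) y
      = Re (fact l * (p / (b * p - to_complex y)) ^ Suc l)"
  using assms(1)
proof (induction l arbitrary: y)
  case 0
  define w0 where "w0 = to_complex y - b * p"
  have ne: "to_complex z - b * p \<noteq> 0" if "z \<noteq> b *\<^sub>R \<eta>" for z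
    using that to_complex_inject[of z "b *\<^sub>R \<eta>"] by (simp add: assms(2))
  have w0: "w0 \<noteq> 0" using ne[OF 0] by (simp add: w0_def)
  have "dir_deriv \<eta> (\<lambda>y. ln (1 / norm (y - b *\<^sub>R \<eta>))) y = Re (- (1 / w0) * to_complex \<eta>)"
  proof (rule dir_deriv_Re_to_complex(2))
    show "open (- {b *\<^sub>R \<eta>})" "y \<in> - {b *\<^sub>R \<eta>}" using 0 by auto
    \<comment> \<open>Dividing by \<open>w0\<close> places the point under consideration at \<open>1\<close>, away from the branch cut;
        \<open>Re Ln\<close> is \<open>ln \<bar>\<cdot>\<bar>\<close> on both sides of the cut.\<close>
    show "((\<lambda>w. - Ln ((w - b * p) / w0) - ln (cmod w0)) has_field_derivative - (1 / w0)) (at (to_complex y))"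
      using w0 by (auto intro!: derivative_eq_intros simp: w0_def[symmetric])
    fix z assume "z \<in> - {b *\<^sub>R \<eta>}"
    then have nz: "to_complex z - b * p \<noteq> 0" using ne by auto
    have "Re (Ln ((to_complex z - b * p) / w0)) = ln (cmod (to_complex z - b * p)) - ln (cmod w0)"
      using nz w0 by (simp add: norm_divide ln_div)
    moreover have "cmod (to_complex z - b * p) = norm (z - b *\<^sub>R \<eta>)"
      using norm_to_complex[of "z - b *\<^sub>R \<eta>"] by (simp add: assms(2))
    moreover have "norm (z - b *\<^sub>R \<eta>) > 0" using \<open>z \<in> - {b *\<^sub>R \<eta>}\<close> by simp
    ultimately show "ln (1 / norm (z - b *\<^sub>R \<eta>)) = Re (- Ln ((to_complex z - b * p) / w0) - ln (cmod w0))"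
      by (simp add: ln_div)
  qed
  also have "- (1 / w0) * to_complex \<eta> = p / (b * p - to_complex y)"
    unfolding w0_def assms(2) by (metis minus_diff_eq minus_divide_left minus_divide_right mult_minus_left times_divide_eq_left mult_1)
  finally show ?case by simp
next
  case (Suc l)
  have ne: "b * p - to_complex y \<noteq> 0"
    using Suc.prems to_complex_inject[of y "b *\<^sub>R \<eta>"] by (simp add: assms(2))
  have "dir_deriv \<eta> ((dir_deriv \<eta> ^^ Suc l) (\<lambda>y. ln (1 / norm (y - b *\<^sub>R \<eta>)))) y
    = Re (fact l * (of_nat (Suc l) * (p / (b * p - to_complex y)) ^ l * (p / (b * p - to_complex y)\<^sup>2)) * to_complex \<eta>)"
  proof (rule dir_deriv_Re_to_complex(2))
    show "open (- {b *\<^sub>R \<eta>})" "y \<in> - {b *\<^sub>R \<eta>}" using Suc.prems by auto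
    have "((\<lambda>w. p / (b * p - w)) has_field_derivative p / (b * p - to_complex y)\<^sup>2) (at (to_complex y))"
      using ne by (auto intro!: derivative_eq_intros simp: power2_eq_square)
    from DERIV_power[OF this, of "Suc l"]
    show "((\<lambda>w. fact l * (p / (b * p - w)) ^ Suc l) has_field_derivative fact l * (of_nat (Suc l) * (p / (b * p - to_complex y)) ^ l * (p / (b * p - to_complex y)\<^sup>2))) (at (to_complex y))"
      by (intro DERIV_cmult) (simp add: mult_ac)
  qed (use Suc.IH in auto)
  also have "fact l * (of_nat (Suc l) * (p / (b * p - to_complex y)) ^ l * (p / (b * p - to_complex y)\<^sup>2)) * to_complex \<eta>
     = fact (Suc l) * (p / (b * p - to_complex y)) ^ Suc (Suc l)"
    unfolding assms(2)[symmetric] by (simp add: power2_eq_square power_divide algebra_simps)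
  finally show ?case by (simp only: funpow.simps o_apply)
qed

lemma kernel_poly_holomorphic: "f holomorphic_on T \<Longrightarrow> (\<lambda>w. kernel_poly n \<epsilon> (f w)) holomorphic_on T"
  unfolding kernel_poly_def Phi_def by (intro holomorphic_intros)

text \<open>The coefficients are real.\<close>

lemma kernel_poly_cnj: "kernel_poly n \<epsilon> (cnj u) = cnj (kernel_poly n \<epsilon> u)"
proof -
  have "cnj (if k = 0 then 1/2 else 0) = (if k = 0 then 1/2 else 0)" for k :: nat by simp
  then show ?thesis unfolding kernel_poly_def Phi_def by simp
qed

lemma kernel_poly_at_1: "kernel_poly n \<epsilon> 1 = of_real (fact (2 * n) / (2 * (fact n * fact (Suc n))))"
proof -
  have "kernel_poly n \<epsilon> 1 = (\<Sum>k\<le>n. if k = 0 then of_real (fact (2 * n) / (2 * (fact n * fact (Suc n)))) else 0)"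
    unfolding kernel_poly_def by (intro sum.cong refl) (simp add: Phi_at_1)
  then show ?thesis by simp
qed

text \<open>Interchanging the sum over \<open>l\<close> with the sum in the definition of \<^const>\<open>Q\<close> collects the
  coefficients \<^const>\<open>A\<close> into the polynomials \<^const>\<open>Phi\<close>.\<close>

lemma H_eq_Re_kernel_poly:
  assumes "y \<noteq> exp \<epsilon> *\<^sub>R \<eta>" and p: "p = to_complex \<eta>"
  shows "H (Suc n) \<epsilon> \<eta> y = Re (kernel_poly n \<epsilon> (of_real (exp \<epsilon>) * p / (of_real (exp \<epsilon>) * p - to_complex y)))"
proof -
  define a where "a = exp \<epsilon>"
  define u where "u = a * p / (a * p - to_complex y)"
  define c where "c k = fact (2 * n - k) / (fact (Suc n) * fact (n - k)) / fact k * (2 * \<epsilon>) ^ k" for k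
  have K: "Re (kernel_poly n \<epsilon> u) = (\<Sum>k\<le>n. c k * (\<Sum>l\<le>k. A k l * Re (u ^ Suc l))) - c 0 / 2"
  proof -
    have "Re (kernel_poly n \<epsilon> u) = (\<Sum>k\<le>n. c k * Re (Phi k u) - (if k = 0 then c 0 / 2 else 0))"
      unfolding kernel_poly_def Re_sum c_def[symmetric] Re_of_real_times by (intro sum.cong refl) (auto simp: algebra_simps)
    also have "\<dots> = (\<Sum>k\<le>n. c k * Re (Phi k u)) - c 0 / 2"
      unfolding sum_subtractf by simp
    finally show ?thesis unfolding Phi_conv_A Re_sum Re_of_real_times .
  qed
  have D: "a ^ Suc l / fact (Suc l) * (dir_deriv \<eta> ^^ Suc l) (\<lambda>y. ln (1 / norm (y - a *\<^sub>R \<eta>))) y = Re (u ^ Suc l) / real (Suc l)" for l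
  proof -
    have "Re (u ^ Suc l) = Re (of_real (a ^ Suc l) * (p / (a * p - to_complex y)) ^ Suc l)"
      by (simp add: u_def power_mult_distrib power_divide mult_ac)
    also have "\<dots> = a ^ Suc l * Re ((p / (a * p - to_complex y)) ^ Suc l)"
      by (rule Re_of_real_times)
    finally have 1: "Re (u ^ Suc l) = a ^ Suc l * Re ((p / (a * p - to_complex y)) ^ Suc l)" .
    have 2: "Re (fact l * (p / (a * p - to_complex y)) ^ Suc l) = fact l * Re ((p / (a * p - to_complex y)) ^ Suc l)"
      by (metis Re_of_real_times of_real_fact)
    show ?thesis
      unfolding dir_deriv_funpow_ln_norm[OF assms(1)[folded a_def] p] 1 2
      by (simp del: power_Suc of_nat_Suc)
  qed
  have regroup: "r * f / g * (x / b) * e * e' * (w / r) = f / g / b * (e * e') * (x * w)"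
    if "r \<noteq> 0" for r f g x b e e' w :: real
    using that by simp
  have "(\<Sum>l=1..Suc n. Q (Suc n) l (2*\<epsilon>) * ((2*\<epsilon>) ^ (l - 1) * a ^ l / fact l)
          * (dir_deriv \<eta> ^^ l) (\<lambda>y. ln (1 / norm (y - a *\<^sub>R \<eta>))) y)
    = (\<Sum>l\<le>n. Q (Suc n) (Suc l) (2*\<epsilon>) * (2*\<epsilon>) ^ l * (Re (u ^ Suc l) / real (Suc l)))"
    unfolding D[symmetric]
    by (rule sum.reindex_bij_witness[of _ Suc "\<lambda>l. l - 1"]) (auto simp: mult_ac)
  also have "\<dots> = (\<Sum>l\<le>n. \<Sum>k=l..n. c k * (A k l * Re (u ^ Suc l)))"
  proof (intro sum.cong refl)
    fix l
    have "Q (Suc n) (Suc l) (2*\<epsilon>) * (2*\<epsilon>) ^ l * (Re (u ^ Suc l) / real (Suc l))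
       = (\<Sum>k=Suc l..Suc n. c (k - 1) * (A (k - 1) l * Re (u ^ Suc l)))"
      unfolding Q_def sum_distrib_right
    proof (intro sum.cong refl)
      fix k assume k: "k \<in> {Suc l..Suc n}"
      then have "k - 1 = (k - Suc l) + l" by auto
      then have pow: "(2 * \<epsilon>) ^ (k - 1) = (2 * \<epsilon>) ^ (k - Suc l) * (2 * \<epsilon>) ^ l"
        by (metis power_add)
      from k have *: "2 * Suc n - k - 1 = 2 * n - (k - 1)" "Suc n - k = n - (k - 1)"
        by auto
      show "real (Suc l) * fact (2 * Suc n - k - 1) / (fact (Suc n) * fact (Suc n - k)) * (A (k - 1) (Suc l - 1) / fact (k - 1)) * (2 * \<epsilon>) ^ (k - Suc l) * (2 * \<epsilon>) ^ l * (Re (u ^ Suc l) / real (Suc l))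
        = c (k - 1) * (A (k - 1) l * Re (u ^ Suc l))"
        unfolding c_def pow * diff_Suc_1 by (rule regroup) simp
    qed
    also have "\<dots> = (\<Sum>k=l..n. c k * (A k l * Re (u ^ Suc l)))"
      by (rule sum.reindex_bij_witness[of _ Suc "\<lambda>l. l - 1"]) auto
    finally show "Q (Suc n) (Suc l) (2*\<epsilon>) * (2*\<epsilon>) ^ l * (Re (u ^ Suc l) / real (Suc l)) = (\<Sum>k=l..n. c k * (A k l * Re (u ^ Suc l)))" .
  qed
  also have "\<dots> = (\<Sum>k\<le>n. \<Sum>l\<le>k. c k * (A k l * Re (u ^ Suc l)))"
  proof -
    have restr: "{l. l \<le> n \<and> l \<le> k} = {..k}" if "k \<le> n" for k using that by auto
    have restr': "{k. k \<le> n \<and> l \<le> k} = {l..n}" for l by auto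
    show ?thesis
      using sum.swap_restrict[of "{..n}" "{..n}" "\<lambda>l k. c k * (A k l * Re (u ^ Suc l))" "\<lambda>l k. l \<le> k"]
      by (simp add: restr restr' del: power_Suc cong: sum.cong_simp)
  qed
  finally show ?thesis
    unfolding H_def Let_def a_def[symmetric] u_def[symmetric] K
    by (simp add: c_def sum_distrib_left)
qed

lemma harmonic_on_H: "harmonic_on (H (Suc n) \<epsilon> \<eta>) (- {exp \<epsilon> *\<^sub>R \<eta>})"
proof (rule harmonic_on_Re_holomorphic)
  define p where "p = to_complex \<eta>"
  show "open (- {exp \<epsilon> *\<^sub>R \<eta>})" "open (- {of_real (exp \<epsilon>) * p})" by auto
  show "(\<lambda>w. kernel_poly n \<epsilon> (of_real (exp \<epsilon>) * p / (of_real (exp \<epsilon>) * p - w))) holomorphic_on (- {of_real (exp \<epsilon>) * p})"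
    by (intro kernel_poly_holomorphic holomorphic_intros) auto
  show "to_complex ` (- {exp \<epsilon> *\<^sub>R \<eta>}) \<subseteq> - {of_real (exp \<epsilon>) * p}"
  proof (rule image_subsetI)
    fix y assume "y \<in> - {exp \<epsilon> *\<^sub>R \<eta>}"
    then have "to_complex y \<noteq> to_complex (exp \<epsilon> *\<^sub>R \<eta>)"
      by (simp only: to_complex_inject Compl_iff singleton_iff not_False_eq_True)
    then show "to_complex y \<in> - {of_real (exp \<epsilon>) * p}"
      by (simp only: to_complex_simps p_def Compl_iff singleton_iff not_False_eq_True)
  qed
  fix y assume "y \<in> - {exp \<epsilon> *\<^sub>R \<eta>}"
  then have ne: "y \<noteq> exp \<epsilon> *\<^sub>R \<eta>" by simp
  show "H (Suc n) \<epsilon> \<eta> y = Re (kernel_poly n \<epsilon> (of_real (exp \<epsilon>) * p / (of_real (exp \<epsilon>) * p - to_complex y)))"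
    by (rule H_eq_Re_kernel_poly[OF ne p_def])
qed

section \<open>Integration over the unit circle\<close>

lemma circle_parametrisation_measurable:
  "(\<lambda>t. vector [cos t, sin t] :: real^2) \<in> measurable (restrict_space lborel {0..<2*pi}) (restrict_space borel (sphere 0 1))"
proof (rule measurable_restrict_space2)
  have "norm (vector [cos t, sin t] :: real^2) = 1" for t
    by (simp add: norm_vec_def L2_set_def sum_2)
  then show "(\<lambda>t. vector [cos t, sin t] :: real^2) \<in> space (restrict_space lborel {0..<2*pi}) \<rightarrow> sphere 0 1"
    by auto
  have "(vector [cos t, sin t] :: real^2) = (\<chi> i. if i = 1 then cos t else sin t)" for t
    by (simp add: vec_eq_iff forall_2)
  moreover have "continuous_on UNIV (\<lambda>t. (\<chi> i. if i = 1 then cos t else sin t) :: real^2)"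
  proof (intro continuous_on_vec_lambda)
    fix i :: 2
    show "continuous_on UNIV (\<lambda>t. if i = 1 then cos t else sin t :: real)"
      by (cases "i = 1") (auto intro!: continuous_intros)
  qed
  ultimately have "(\<lambda>t. vector [cos t, sin t] :: real^2) \<in> borel_measurable borel"
    by (simp add: borel_measurable_continuous_onI)
  then show "(\<lambda>t. vector [cos t, sin t] :: real^2) \<in> borel_measurable (restrict_space lborel {0..<2*pi})"
    by (intro measurable_restrict_space1) simp
qed

text \<open>The mean value property, from Cauchy's integral formula at the centre.\<close>

lemma has_bochner_integral_arc_measure_holomorphic:
  assumes "open T" and h: "h holomorphic_on T" and T: "cball 0 1 \<subseteq> T"
  shows "has_bochner_integral arc_measure (\<lambda>x. Re (h (to_complex x))) (2 * pi * Re (h 0))"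
proof -
  define g where "g t = Re (h (cis t))" for t
  have cont: "continuous_on A g" for A
    unfolding g_def
    by (intro continuous_intros continuous_on_compose2[OF holomorphic_on_imp_continuous_on[OF h]] continuous_on_cis) (use T in auto)
  have "((\<lambda>u. h u / (u - 0)) has_contour_integral (2 * of_real pi * \<i> * h 0)) (circlepath 0 1)"
    by (rule Cauchy_integral_circlepath_simple) (use h T in \<open>auto intro: holomorphic_on_subset\<close>)
  then have "((\<lambda>x. h (circlepath 0 1 x) / circlepath 0 1 x * (2 * pi * \<i> * exp (2 * of_real pi * \<i> * x))) has_integral (2 * of_real pi * \<i> * h 0)) {0..1}"
    unfolding has_contour_integral vector_derivative_circlepath by simp
  moreover have "circlepath 0 1 x = cis (2 * pi * x)" "exp (2 * of_real pi * \<i> * x) = cis (2 * pi * x)" for x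
    by (simp_all add: circlepath cis_conv_exp mult_ac)
  ultimately have "((\<lambda>x. 2 * pi * \<i> * h (cis (2 * pi * x))) has_integral (2 * of_real pi * \<i> * h 0)) {0..1}"
    by (simp add: field_simps)
  from has_integral_mult_right[OF this, of "1 / (2 * pi * \<i>)"]
  have "((\<lambda>x. h (cis (2 * pi * x))) has_integral h 0) {0..1}" by simp
  from has_integral_linear[OF this bounded_linear_Re]
  have "((\<lambda>x. g (2 * pi * x)) has_integral Re (h 0)) {0..1}"
    by (simp add: o_def g_def)
  from has_integral_affinity'[OF this[folded cbox_interval], of "1 / (2 * pi)" 0]
  have gint: "(g has_integral (2 * pi * Re (h 0))) {0..2*pi}" by simp
  have "set_integrable lborel {0..2*pi} g"
    by (rule borel_integrable_atLeastAtMost'[OF cont])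
  from set_borel_integral_eq_integral(2)[OF this] this gint
  have closed: "has_bochner_integral lborel (\<lambda>t. indicator {0..2*pi} t *\<^sub>R g t) (2 * pi * Re (h 0))"
    by (simp add: has_bochner_integral_iff set_integrable_def set_lebesgue_integral_def integral_unique)
  have "g \<in> borel_measurable borel" using cont by (rule borel_measurable_continuous_onI)
  then have meas: "(\<lambda>t. indicator B t *\<^sub>R g t) \<in> borel_measurable lborel" if "B \<in> sets borel" for B
    using that by (intro borel_measurable_scaleR) simp_all
  have ae: "AE t in lborel. indicator {0..2*pi} t *\<^sub>R g t = indicator {0..<2*pi} t *\<^sub>R g t"
    using AE_lborel_singleton[of "2 * pi"] by eventually_elim (auto simp: indicator_def)
  have "has_bochner_integral lborel (\<lambda>t. indicator {0..<2*pi} t *\<^sub>R g t) (2 * pi * Re (h 0))"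
    by (rule has_bochner_integral_cong_AE[THEN iffD1, OF meas meas ae closed]) simp_all
  then have "has_bochner_integral (restrict_space lborel {0..<2*pi}) g (2 * pi * Re (h 0))"
    by (subst has_bochner_integral_restrict_space) auto
  moreover have "to_complex (vector [cos t, sin t]) = cis t" for t
    by (simp add: complex_eq_iff)
  moreover have "continuous_on (sphere 0 1) (\<lambda>x. Re (h (to_complex x)))"
    by (intro continuous_intros continuous_on_compose2[OF holomorphic_on_imp_continuous_on[OF h]]
            linear_continuous_on bounded_linear_to_complex) (use T in auto)
  ultimately show ?thesis unfolding arc_measure_def
    by (intro has_bochner_integral_distr circle_parametrisation_measurable borel_measurable_continuous_on_restrict)
       (simp_all add: g_def[abs_def])
qed

lemma space_arc_measure [simp]: "space arc_measure = sphere 0 1"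
  by (simp add: arc_measure_def space_restrict_space)

section \<open>The kernel on the unit circle\<close>

lemma kernel_summable_and_bound:
  assumes "0 < \<epsilon>" "\<epsilon> \<le> 1" "0 \<le> \<rho>" "\<rho> \<le> pi" "m \<ge> 1"
  defines "f \<equiv> \<lambda>j::int. inverse \<epsilon> / (1 + (inverse \<epsilon>)\<^sup>2 * (\<rho> + 2 * pi * of_int j)\<^sup>2) ^ m"
  shows "f summable_on UNIV" "infsum f UNIV > 0"
    "infsum f UNIV \<le> 4 ^ m * (inverse \<epsilon> / (1 + inverse \<epsilon> * \<rho>) ^ (2 * m)) * infsum inv_square_bound UNIV"
proof -
  define C where "C = 4 ^ m * (inverse \<epsilon> / (1 + inverse \<epsilon> * \<rho>) ^ (2 * m))"
  have pos: "f j > 0" for j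
    unfolding f_def using assms by (auto intro!: divide_pos_pos zero_less_power add_pos_nonneg)
  have le: "f j \<le> C * inv_square_bound j" for j
    unfolding f_def C_def by (rule kernel_term_bound[OF assms(1-5)])
  have sC: "(\<lambda>j. C * inv_square_bound j) summable_on UNIV"
    by (intro summable_on_cmult_right inv_square_bound_summable)
  show sm: "f summable_on UNIV"
    by (rule summable_on_comparison_test[OF sC]) (use le pos in \<open>auto intro: less_imp_le\<close>)
  have "sum f {0} \<le> infsum f UNIV"
    by (rule finite_sum_le_infsum[OF sm]) (use pos in \<open>auto intro: less_imp_le\<close>)
  with pos[of 0] show "infsum f UNIV > 0" by simp
  have "infsum f UNIV \<le> infsum (\<lambda>j. C * inv_square_bound j) UNIV"
    by (intro infsum_mono sm sC le)
  then show "infsum f UNIV \<le> C * infsum inv_square_bound UNIV"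
    by (simp add: infsum_cmult_right')
qed

lemma G_eq_Re_kernel_poly:
  assumes "0 < \<epsilon>" "\<epsilon> \<le> 1" "-1 \<le> t" "t \<le> 1"
  shows "G (Suc n) \<epsilon> t = Re (kernel_poly n \<epsilon> (1 / (1 - exp (- (of_real \<epsilon> + \<i> * of_real (arccos t))))))"
proof -
  have "0 \<le> arccos t" "arccos t \<le> pi" using assms by (auto intro: arccos_lbound arccos_ubound)
  from kernel_summable_and_bound(1)[OF assms(1,2) this, of "Suc n"]
  show ?thesis using kernel_series_eq[OF assms(1), of "arccos t" n] by (simp add: G_def)
qed

text \<open>In complex notation \<open>X = x cnj \<eta>\<close> has modulus \<open>1\<close> and real part \<open>cos \<rho>\<close>, so it is \<open>cis \<rho>\<close> or
  \<open>cis (-\<rho>)\<close>. \<^const>\<open>H\<close> involves \<open>X\<close> and \<^const>\<open>G\<close> involves \<open>cis (-\<rho>)\<close>; conjugation does not change the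
  real part.\<close>

lemma G_eq_H:
  assumes "0 < \<epsilon>" "\<epsilon> \<le> 1" "\<eta> \<in> sphere 0 1" "x \<in> sphere 0 1"
  shows "G (Suc n) \<epsilon> (x \<bullet> \<eta>) = H (Suc n) \<epsilon> \<eta> x"
proof -
  define p where "p = to_complex \<eta>"
  define X where "X = to_complex x * cnj p"
  define \<rho> where "\<rho> = arccos (x \<bullet> \<eta>)"
  have np: "cmod p = 1" and nx: "cmod (to_complex x) = 1" using assms by (simp_all add: p_def)
  have "norm x = 1" "norm \<eta> = 1" using assms by simp_all
  then have b: "\<bar>x \<bullet> \<eta>\<bar> \<le> 1" using Cauchy_Schwarz_ineq2[of x \<eta>] by simp
  have ReX: "Re X = cos \<rho>"
    using b by (simp add: X_def p_def \<rho>_def Re_to_complex_mult_cnj del: times_complex.simps complex_cnj)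
  have "cmod X = 1" using np nx by (simp add: X_def norm_mult)
  then have "(Im X)\<^sup>2 = (sin \<rho>)\<^sup>2"
    using cmod_power2[of X] unfolding ReX by (simp add: sin_squared_eq)
  then have "Im X = sin \<rho> \<or> Im X = - sin \<rho>" by (simp add: power2_eq_iff)
  then have X: "X = cis \<rho> \<or> X = cis (- \<rho>)" using ReX by (auto simp: complex_eq_iff)
  define V where "V w = 1 / (1 - exp (- of_real \<epsilon>) * w)" for w :: complex
  have u: "1 / (1 - exp (- (of_real \<epsilon> + \<i> * of_real \<rho>))) = V (cis (- \<rho>))"
    by (simp add: V_def cis_conv_exp exp_add[symmetric] algebra_simps)
  have xne: "x \<noteq> exp \<epsilon> *\<^sub>R \<eta>"
    using assms by auto
  have pp: "p * cnj p = 1" using np complex_norm_square[of p] by simp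
  have "of_real (exp \<epsilon>) * p / (of_real (exp \<epsilon>) * p - to_complex x) = V X"
  proof -
    have "of_real (exp \<epsilon>) * p * (1 - exp (- of_real \<epsilon>) * X) = of_real (exp \<epsilon>) * p - to_complex x"
    proof -
      have "of_real (exp \<epsilon>) * p * (1 - exp (- of_real \<epsilon>) * X) = of_real (exp \<epsilon>) * p - (exp (of_real \<epsilon>) * exp (- of_real \<epsilon>)) * to_complex x * (p * cnj p)"
        by (simp add: X_def algebra_simps exp_of_real)
      then show ?thesis unfolding pp by (simp add: exp_minus_inverse)
    qed
    moreover have "of_real (exp \<epsilon>) * p \<noteq> 0" using np by auto
    ultimately show ?thesis
      unfolding V_def by (metis mult.right_neutral nonzero_mult_divide_mult_cancel_left)
  qed
  then have HX: "H (Suc n) \<epsilon> \<eta> x = Re (kernel_poly n \<epsilon> (V X))"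
    using H_eq_Re_kernel_poly[OF xne p_def, of n] by simp
  have "V (cis \<rho>) = cnj (V (cis (- \<rho>)))"
    by (simp add: V_def cis_cnj exp_cnj)
  then have "Re (kernel_poly n \<epsilon> (V (cis \<rho>))) = Re (kernel_poly n \<epsilon> (V (cis (- \<rho>))))"
    by (simp add: kernel_poly_cnj)
  then have "Re (kernel_poly n \<epsilon> (V X)) = Re (kernel_poly n \<epsilon> (V (cis (- \<rho>))))" using X by auto
  moreover have "G (Suc n) \<epsilon> (x \<bullet> \<eta>) = Re (kernel_poly n \<epsilon> (V (cis (- \<rho>))))"
    using G_eq_Re_kernel_poly[OF assms(1,2), of "x \<bullet> \<eta>" n] b unfolding \<rho>_def[symmetric] u by simp
  ultimately show ?thesis unfolding HX by simp
qed

lemma has_bochner_integral_G: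
  assumes "0 < \<epsilon>" "\<epsilon> \<le> 1" "\<eta> \<in> sphere 0 1"
  shows "has_bochner_integral arc_measure (\<lambda>x. G (Suc n) \<epsilon> (x \<bullet> \<eta>)) (pi * fact (2 * n) / (fact n * fact (Suc n)))"
proof -
  define p where "p = to_complex \<eta>"
  define h where "h w = kernel_poly n \<epsilon> (of_real (exp \<epsilon>) * p / (of_real (exp \<epsilon>) * p - w))" for w
  have np: "cmod p = 1" using assms by (simp add: p_def)
  have "has_bochner_integral arc_measure (\<lambda>x. Re (h (to_complex x))) (2 * pi * Re (h 0))"
  proof (rule has_bochner_integral_arc_measure_holomorphic)
    show "open (- {of_real (exp \<epsilon>) * p})" by auto
    show "h holomorphic_on (- {of_real (exp \<epsilon>) * p})"
      unfolding h_def by (intro kernel_poly_holomorphic holomorphic_intros) auto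
    have "cmod (of_real (exp \<epsilon>) * p) > 1" using np assms by (simp add: norm_mult)
    then show "cball 0 1 \<subseteq> - {of_real (exp \<epsilon>) * p}" by auto
  qed
  also have "2 * pi * Re (h 0) = pi * fact (2 * n) / (fact n * fact (Suc n))"
  proof -
    have "of_real (exp \<epsilon>) * p / (of_real (exp \<epsilon>) * p - 0) = 1" using np by auto
    then have "h 0 = of_real (fact (2 * n) / (2 * (fact n * fact (Suc n))))"
      unfolding h_def by (simp only: kernel_poly_at_1)
    then have "Re (h 0) = fact (2 * n) / (2 * (fact n * fact (Suc n)))"
      by (simp only: Re_complex_of_real)
    then show ?thesis by simp
  qed
  also have "has_bochner_integral arc_measure (\<lambda>x. Re (h (to_complex x))) (pi * fact (2 * n) / (fact n * fact (Suc n)))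
     \<longleftrightarrow> has_bochner_integral arc_measure (\<lambda>x. G (Suc n) \<epsilon> (x \<bullet> \<eta>)) (pi * fact (2 * n) / (fact n * fact (Suc n)))"
  proof (intro has_bochner_integral_cong refl)
    fix x assume "x \<in> space arc_measure"
    then have "x \<in> sphere 0 1" by simp
    moreover from this have "x \<noteq> exp \<epsilon> *\<^sub>R \<eta>" using assms by auto
    ultimately show "Re (h (to_complex x)) = G (Suc n) \<epsilon> (x \<bullet> \<eta>)"
      using G_eq_H[OF assms, of x n] H_eq_Re_kernel_poly[of x \<epsilon> \<eta> p n] by (simp add: h_def p_def)
  qed
  finally show ?thesis .
qed

theorem theorem4p1:
  fixes m :: nat
  assumes "m \<ge> 1"
  shows "\<exists>c::real. c > 0 \<and>
    (\<forall>\<epsilon>::real. \<forall>\<eta>::real^2. 0 < \<epsilon> \<and> \<epsilon> \<le> 1 \<and> \<eta> \<in> sphere 0 1 \<longrightarrow>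
      (\<forall>x\<in>sphere 0 1. 0 < G m \<epsilon> (x \<bullet> \<eta>) \<and>
         G m \<epsilon> (x \<bullet> \<eta>) \<le> c * (inverse \<epsilon> / (1 + inverse \<epsilon> * geodist x \<eta>) ^ (2*m))) \<and>
      has_bochner_integral arc_measure (\<lambda>x. G m \<epsilon> (x \<bullet> \<eta>))
         (pi * fact (2*m - 2) / (fact (m - 1) * fact m)) \<and>
      harmonic_on (H m \<epsilon> \<eta>) (- {exp \<epsilon> *\<^sub>R \<eta>}) \<and>
      (\<forall>x\<in>sphere 0 1. G m \<epsilon> (x \<bullet> \<eta>) = H m \<epsilon> \<eta> x))"
proof -
  obtain n where m: "m = Suc n" using assms by (cases m) auto
  define B where "B = infsum inv_square_bound UNIV"
  define c where "c = 2 ^ (2 * m - 2) / real m * (4 ^ m * B)"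
  have "sum inv_square_bound {0} \<le> B"
    unfolding B_def
    by (rule finite_sum_le_infsum[OF inv_square_bound_summable]) (auto intro: less_imp_le inv_square_bound_pos)
  then have "B > 0" using inv_square_bound_pos[of 0] by simp
  then have "c > 0" using assms by (simp add: c_def)
  have bound: "0 < G m \<epsilon> (x \<bullet> \<eta>) \<and> G m \<epsilon> (x \<bullet> \<eta>) \<le> c * (inverse \<epsilon> / (1 + inverse \<epsilon> * geodist x \<eta>) ^ (2*m))"
    if "0 < \<epsilon>" "\<epsilon> \<le> 1" "\<eta> \<in> sphere 0 1" "x \<in> sphere 0 1" for \<epsilon> and \<eta> x :: "real^2"
  proof -
    have "\<bar>x \<bullet> \<eta>\<bar> \<le> 1" using Cauchy_Schwarz_ineq2[of x \<eta>] that by simp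
    then have \<rho>: "0 \<le> arccos (x \<bullet> \<eta>)" "arccos (x \<bullet> \<eta>) \<le> pi"
      by (auto intro: arccos_lbound arccos_ubound)
    note S = kernel_summable_and_bound(2,3)[OF that(1,2) \<rho> assms]
    have pre: "0 < 2 ^ (2 * m - 2) / real m" using assms by simp
    show ?thesis
      using mult_pos_pos[OF pre S(1)] mult_left_mono[OF S(2) less_imp_le[OF pre]]
      by (simp add: G_def c_def B_def geodist_def mult_ac)
  qed
  have "has_bochner_integral arc_measure (\<lambda>x. G m \<epsilon> (x \<bullet> \<eta>)) (pi * fact (2*m - 2) / (fact (m - 1) * fact m))"
    if "0 < \<epsilon>" "\<epsilon> \<le> 1" "\<eta> \<in> sphere 0 1" for \<epsilon> and \<eta> :: "real^2"
    using has_bochner_integral_G[OF that, of n] by (simp add: m del: fact_Suc)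
  with bound \<open>c > 0\<close> show ?thesis
    unfolding m by (intro exI[of _ c]) (blast intro: harmonic_on_H G_eq_H)
qed

thm_deps theorem4p1

end
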